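(* Let $\ell,k,d,m\in\mathbb{Z}_{>0}$ with $k\mid\ell$ and $m>d$. Put $n=\ell m$, $\mathbf{p}=(m,m,\dots,m)\in\mathbb{Z}_{>0}^\ell$ and $V=\mathbb{C}^n$. Then the action of the free product $\mathbf{GL}_{\mathbf{p}}*\mathbb{Z}$ and the restricted action of $A_{(\ell,k,d)}$ on $V^{\otimes d}$ (described in the context) have the double centralizer property: in $\mathrm{End}_{\mathbb{C}}(V^{\otimes d})$, the image of $A_{(\ell,k,d)}$ is the centralizer of the image of $\mathbb{C}[\mathbf{GL}_{\mathbf{p}}*\mathbb{Z}]$, and the image of $\mathbb{C}[\mathbf{GL}_{\mathbf{p}}*\mathbb{Z}]$ is the centralizer of the image of $A_{(\ell,k,d)}$.
   Context: Write $\underline{n}=\{1,\dots,n\}$. $V=\mathbb{C}^n$ has standard basis $v_1,\dots,v_n$. $\mathbf{GL}_{\mathbf{p}}\cong\mathbf{GL}_m(\mathbb{C})^{\times\ell}$ is the subgroup of block diagonal matrices in $\mathbf{GL}_n(\mathbb{C})$ with $\ell$ blocks of size $m$, acting naturally on $V$. The generator $1\in\mathbb{Z}$ acts on $V$ by $v_i\mapsto v_{i+\frac{\ell}{k}m}$, with the convention $v_s=v_{s-n}$ for $s>n$. This defines an action of the free product $\mathbf{GL}_{\mathbf{p}}*\mathbb{Z}$ on $V$, and it acts diagonally on $V^{\otimes d}$. Let $V_i$ be the span of $v_j$ with $(i-1)m<j\leq im$, so $V=V_1\oplus\dots\oplus V_\ell$. The groupoid $\mathcal{G}_{(\ell,d)}$: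 objects are all maps $f:\underline{d}\to\underline{\ell}$; morphisms from $f$ to $g$ are all bijections $\sigma:\underline{d}\to\underline{d}$ with $g\circ\sigma=f$; composition is composition of maps. $A_{(\ell,d)}$ is the algebra with basis all morphisms of $\mathcal{G}_{(\ell,d)}$, product being composition if defined and $0$ otherwise. It acts on $V^{\otimes d}=\bigoplus_f\mathrm{G}(f)$, where $\mathrm{G}(f)=V_{f(1)}\otimes\dots\otimes V_{f(d)}$: a morphism $\sigma:f\to g$ maps $\mathrm{G}(f)$ to $\mathrm{G}(g)$ by $w_1\otimes\dots\otimes w_d\mapsto w_{\sigma^{-1}(1)}\otimes\dots\otimes w_{\sigma^{-1}(d)}$ and is zero on $\mathrm{G}(f')$ for $f'\neq f$. Let $\theta$ be the cyclic permutation $1\mapsto 2\mapsto\dots\mapsto\ell\mapsto 1$ of $\underline{\ell}$, $\theta_k=\theta^{\ell/k}$ and $H_k=\langle\theta_k\rangle$ (of order $k$). $H_k$ acts freely by automorphisms on $\mathcal{G}_{(\ell,d)}$: $h$ sends an object $f$ to $h\circ f$ and a morphism $\sigma:f\to g$ to the same bijection viewed as a morphism $h\circ f\to h\circ g$. The quotient groupoid $\mathcal{G}^k_{(\ell,d)}$ has as objects the $H_k$-orbits $f^{(k)}$ of objects and as morphisms $f^{(k)}\to g^{(k)}$ the $H_k$-orbits $\sigma^{(k)}$ on $\coprod_{f'\in f^{(k)},g'\in g^{(k)}}\mathcal{G}_{(\ell,d)}(f',g')$, with composition induced from $\mathcal{G}_{(\ell,d)}$. $A_{(\ell,k,d)}$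 is the algebra with basis all morphisms of $\mathcal{G}^k_{(\ell,d)}$, product being composition if defined and $0$ otherwise. It is regarded as a subalgebra of $A_{(\ell,d)}$ via the injective homomorphism $\Psi$ sending $\sigma^{(k)}$ to $\sum_{\tau\in\sigma^{(k)}}\tau$, and its restricted action on $V^{\otimes d}$ is obtained through $\Psi$. *)

theory Defs
  imports
    "HOL-Algebra.Bij"
    "HOL-Algebra.Generated_Groups"
    "HOL-Algebra.Elementary_Groups"
    "HOL-Algebra.Module"
    "HOL-Combinatorics.Permutations"
    "HOL-Number_Theory.Cong"
    "Jordan_Normal_Form.Matrix"
begin

text \<open>
  Conventions. All index sets are zero-based: the sets with \<open>d\<close>, \<open>l\<close> and \<open>n\<close> elements are
  \<open>{..<d}\<close>, \<open>{..<l}\<close> and \<open>{..<n}\<close>. Thus the basis vector \<open>j\<close> of the \<open>l * m\<close>-dimensional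
  space lies in the block \<open>j div m\<close>, and the cyclic permutation is \<open>i \<mapsto> (i + 1) mod l\<close>.
\<close>

section \<open>Algebras with a distinguished basis\<close>

text \<open>
  The complex algebra with basis \<open>B\<close>, in which the product of two basis elements is given by the
  partial multiplication \<open>pmul\<close> and is 0 where \<open>pmul\<close> is undefined. Elements are finitely
  supported coefficient functions; the unit is the sum of the elements of \<open>E\<close>.
\<close>

definition basis_algebra ::
    "'b set \<Rightarrow> 'b set \<Rightarrow> ('b \<Rightarrow> 'b \<Rightarrow> 'b option) \<Rightarrow> (complex, 'b \<Rightarrow> complex) module" where
  "basis_algebra B E pmul =
    \<lparr>carrier = {a. finite {x. a x \<noteq> 0} \<and> {x. a x \<noteq> 0} \<subseteq> B},
     monoid.mult = (\<lambda>a b z.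
       \<Sum>(x, y) \<in> {(x, y). a x \<noteq> 0 \<and> b y \<noteq> 0 \<and> pmul x y = Some z}. a x * b y),
     one = (\<lambda>x. if x \<in> E then 1 else 0),
     zero = (\<lambda>x. 0),
     add = (\<lambda>a b x. a x + b x),
     smult = (\<lambda>c a x. c * a x)\<rparr>"

definition group_algebra :: "'g monoid \<Rightarrow> (complex, 'g \<Rightarrow> complex) module" where
  "group_algebra G =
    basis_algebra (carrier G) {\<one>\<^bsub>G\<^esub>} (\<lambda>x y. Some (x \<otimes>\<^bsub>G\<^esub> y))"

section \<open>Free products of two groups\<close>

definition fp_words :: "'a monoid \<Rightarrow> 'b monoid \<Rightarrow> ('a + 'b) list set" where
  "fp_words G H = lists (carrier G <+> carrier H)"

inductive fp_cong :: "'a monoid \<Rightarrow> 'b monoid \<Rightarrow> ('a + 'b) list \<Rightarrow> ('a + 'b) list \<Rightarrow> bool"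
  for G H where
  fp_cong_refl: "u \<in> fp_words G H \<Longrightarrow> fp_cong G H u u"
| fp_cong_sym: "fp_cong G H u v \<Longrightarrow> fp_cong G H v u"
| fp_cong_trans: "fp_cong G H u v \<Longrightarrow> fp_cong G H v w \<Longrightarrow> fp_cong G H u w"
| fp_cong_one_left: "u \<in> fp_words G H \<Longrightarrow> v \<in> fp_words G H \<Longrightarrow> fp_cong G H (u @ [Inl \<one>\<^bsub>G\<^esub>] @ v) (u @ v)"
| fp_cong_one_right: "u \<in> fp_words G H \<Longrightarrow> v \<in> fp_words G H \<Longrightarrow> fp_cong G H (u @ [Inr \<one>\<^bsub>H\<^esub>] @ v) (u @ v)"
| fp_cong_mult_left: "u \<in> fp_words G H \<Longrightarrow> v \<in> fp_words G H \<Longrightarrow> a \<in> carrier G \<Longrightarrow> b \<in> carrier G \<Longrightarrow>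
    fp_cong G H (u @ [Inl a, Inl b] @ v) (u @ [Inl (a \<otimes>\<^bsub>G\<^esub> b)] @ v)"
| fp_cong_mult_right: "u \<in> fp_words G H \<Longrightarrow> v \<in> fp_words G H \<Longrightarrow> a \<in> carrier H \<Longrightarrow> b \<in> carrier H \<Longrightarrow>
    fp_cong G H (u @ [Inr a, Inr b] @ v) (u @ [Inr (a \<otimes>\<^bsub>H\<^esub> b)] @ v)"

definition fp_rel :: "'a monoid \<Rightarrow> 'b monoid \<Rightarrow> (('a + 'b) list \<times> ('a + 'b) list) set" where
  "fp_rel G H = {(u, v). fp_cong G H u v}"

definition free_product :: "'a monoid \<Rightarrow> 'b monoid \<Rightarrow> ('a + 'b) list set monoid" where
  "free_product G H =
    \<lparr>carrier = fp_words G H // fp_rel G H,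
     monoid.mult = (\<lambda>X Y. \<Union>u\<in>X. \<Union>v\<in>Y. fp_rel G H `` {u @ v}),
     one = fp_rel G H `` {[]}\<rparr>"

lemma fp_cong_append:
  assumes "fp_cong G H u u'" "w \<in> fp_words G H"
  shows "fp_cong G H (u @ w) (u' @ w)" "fp_cong G H (w @ u) (w @ u')"
proof -
  have app: "x @ y \<in> fp_words G H" if "x \<in> fp_words G H" "y \<in> fp_words G H" for x y
    using that by (simp add: fp_words_def)
  show "fp_cong G H (u @ w) (u' @ w)"
    using assms(1)
  proof (induction rule: fp_cong.induct)
    case (fp_cong_one_left u v)
    then show ?case using fp_cong.fp_cong_one_left[of u G H "v @ w"] app assms(2) by simp
  next
    case (fp_cong_one_right u v)
    then show ?case using fp_cong.fp_cong_one_right[of u G H "v @ w"] app assms(2) by simp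
  next
    case (fp_cong_mult_left u v a b)
    then show ?case using fp_cong.fp_cong_mult_left[of u G H "v @ w" a b] app assms(2) by simp
  next
    case (fp_cong_mult_right u v a b)
    then show ?case using fp_cong.fp_cong_mult_right[of u G H "v @ w" a b] app assms(2) by simp
  qed (use app assms(2) in \<open>blast intro: fp_cong.intros(1-3)\<close>)+
  show "fp_cong G H (w @ u) (w @ u')"
    using assms(1)
  proof (induction rule: fp_cong.induct)
    case (fp_cong_one_left u v)
    then show ?case using fp_cong.fp_cong_one_left[of "w @ u" G H v] app assms(2) by simp
  next
    case (fp_cong_one_right u v)
    then show ?case using fp_cong.fp_cong_one_right[of "w @ u" G H v] app assms(2) by simp
  next
    case (fp_cong_mult_left u v a b)
    then show ?case using fp_cong.fp_cong_mult_left[of "w @ u" G H v a b] app assms(2) by simp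
  next
    case (fp_cong_mult_right u v a b)
    then show ?case using fp_cong.fp_cong_mult_right[of "w @ u" G H v a b] app assms(2) by simp
  qed (use app assms(2) in \<open>blast intro: fp_cong.intros(1-3)\<close>)+
qed

lemma fp_cong_words:
  assumes "group G" "group H" "fp_cong G H u v"
  shows "u \<in> fp_words G H \<and> v \<in> fp_words G H"
proof -
  interpret G: group G by fact
  interpret H: group H by fact
  show ?thesis
    using assms(3) by (induction rule: fp_cong.induct) (simp_all add: fp_words_def InlI InrI)
qed

lemma free_product_mult:
  assumes "group G" "group H" "u \<in> fp_words G H" "v \<in> fp_words G H"
  shows "(fp_rel G H `` {u}) \<otimes>\<^bsub>free_product G H\<^esub> (fp_rel G H `` {v}) = fp_rel G H `` {u @ v}"
proof -
  have *: "fp_cong G H (u @ v) (u' @ v')" if "fp_cong G H u u'" "fp_cong G H v v'" for u' v'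
  proof -
    have "u' \<in> fp_words G H" using fp_cong_words[OF assms(1,2) that(1)] by simp
    then show ?thesis
      using fp_cong_trans[OF fp_cong_append(1)[OF that(1) assms(4)] fp_cong_append(2)[OF that(2)]]
      by simp
  qed
  have eq: "fp_rel G H `` {x} = fp_rel G H `` {y}" if "fp_cong G H y x" for x y
    unfolding fp_rel_def using fp_cong_trans[OF that] fp_cong_trans[OF fp_cong_sym[OF that]]
    by blast
  have "fp_rel G H `` {u' @ v'} = fp_rel G H `` {u @ v}"
    if "u' \<in> fp_rel G H `` {u}" "v' \<in> fp_rel G H `` {v}" for u' v'
    using that by (intro eq *) (simp_all add: fp_rel_def)
  moreover have "u \<in> fp_rel G H `` {u}" "v \<in> fp_rel G H `` {v}"
    using fp_cong_refl[OF assms(3)] fp_cong_refl[OF assms(4)] by (simp_all add: fp_rel_def)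
  ultimately have "(\<Union>u'\<in>fp_rel G H `` {u}. \<Union>v'\<in>fp_rel G H `` {v}. fp_rel G H `` {u' @ v'}) =
      fp_rel G H `` {u @ v}"
    by blast
  then show ?thesis by (simp add: free_product_def)
qed

definition fp_eval :: "('c, 'x) monoid_scheme \<Rightarrow> ('a \<Rightarrow> 'c) \<Rightarrow> ('b \<Rightarrow> 'c) \<Rightarrow> ('a + 'b) list \<Rightarrow> 'c" where
  "fp_eval K \<phi> \<psi> w = foldr (\<lambda>s x. case_sum \<phi> \<psi> s \<otimes>\<^bsub>K\<^esub> x) w \<one>\<^bsub>K\<^esub>"

text \<open>
  The homomorphism out of the free product induced by homomorphisms \<open>\<phi>\<close> and \<open>\<psi>\<close> into \<open>K\<close>;
  all words in one class have the same value, see \<open>fp_lift_class\<close>.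
\<close>

definition fp_lift ::
    "('c, 'x) monoid_scheme \<Rightarrow> ('a \<Rightarrow> 'c) \<Rightarrow> ('b \<Rightarrow> 'c) \<Rightarrow> ('a + 'b) list set \<Rightarrow> 'c" where
  "fp_lift K \<phi> \<psi> X = the_elem (fp_eval K \<phi> \<psi> ` X)"

lemma fp_lift_class:
  assumes "group G" "group H" "group K" "\<phi> \<in> hom G K" "\<psi> \<in> hom H K" "w \<in> fp_words G H"
  shows "fp_lift K \<phi> \<psi> (fp_rel G H `` {w}) = fp_eval K \<phi> \<psi> w"
proof -
  interpret G: group G by fact
  interpret H: group H by fact
  interpret K: group K by fact
  let ?ev = "fp_eval K \<phi> \<psi>"
  have \<phi>: "\<And>x. x \<in> carrier G \<Longrightarrow> \<phi> x \<in> carrier K"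
    and \<psi>: "\<And>x. x \<in> carrier H \<Longrightarrow> \<psi> x \<in> carrier K"
    using assms(4,5) by (auto simp: hom_def)
  have cl: "?ev u \<in> carrier K" if "u \<in> fp_words G H" for u
    using that by (induction u) (auto simp: fp_eval_def fp_words_def \<phi> \<psi>)
  have app: "?ev (u @ v) = ?ev u \<otimes>\<^bsub>K\<^esub> ?ev v" if "u \<in> fp_words G H" "v \<in> fp_words G H" for u v
    using that(1)
  proof (induction u)
    case Nil
    then show ?case using cl[OF that(2)] by (simp add: fp_eval_def)
  next
    case (Cons s u)
    have u: "u \<in> fp_words G H" and s: "case_sum \<phi> \<psi> s \<in> carrier K"
      using Cons.prems by (auto simp: fp_words_def \<phi> \<psi>)
    show ?case
      using Cons.IH[OF u] K.m_assoc[OF s cl[OF u] cl[OF that(2)]] by (simp add: fp_eval_def)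
  qed
  have one: "\<phi> \<one>\<^bsub>G\<^esub> = \<one>\<^bsub>K\<^esub>" "\<psi> \<one>\<^bsub>H\<^esub> = \<one>\<^bsub>K\<^esub>"
    using hom_one[OF assms(4)] hom_one[OF assms(5)] assms(1-3) by simp_all
  have congr: "fp_cong G H u v \<Longrightarrow> ?ev u = ?ev v" for u v
  proof (induction rule: fp_cong.induct)
    case (fp_cong_one_left u v)
    have "?ev ([Inl \<one>\<^bsub>G\<^esub>] @ v) = ?ev v"
      using cl[OF fp_cong_one_left(2)] by (simp add: fp_eval_def one)
    moreover have "[Inl \<one>\<^bsub>G\<^esub>] @ v \<in> fp_words G H"
      using fp_cong_one_left(2) by (simp add: fp_words_def InlI InrI)
    ultimately show ?case using app fp_cong_one_left by metis
  next
    case (fp_cong_one_right u v)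
    have "?ev ([Inr \<one>\<^bsub>H\<^esub>] @ v) = ?ev v"
      using cl[OF fp_cong_one_right(2)] by (simp add: fp_eval_def one)
    moreover have "[Inr \<one>\<^bsub>H\<^esub>] @ v \<in> fp_words G H"
      using fp_cong_one_right(2) by (simp add: fp_words_def InlI InrI)
    ultimately show ?case using app fp_cong_one_right by metis
  next
    case (fp_cong_mult_left u v a b)
    have "?ev ([Inl a, Inl b] @ v) = ?ev ([Inl (a \<otimes>\<^bsub>G\<^esub> b)] @ v)"
      using cl[OF fp_cong_mult_left(2)] hom_mult[OF assms(4) fp_cong_mult_left(3,4)] fp_cong_mult_left(3,4)
      by (simp add: fp_eval_def \<phi> K.m_assoc)
    moreover have "[Inl a, Inl b] @ v \<in> fp_words G H" "[Inl (a \<otimes>\<^bsub>G\<^esub> b)] @ v \<in> fp_words G H"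
      using fp_cong_mult_left by (simp_all add: fp_words_def InlI InrI)
    ultimately show ?case using app fp_cong_mult_left(1) by metis
  next
    case (fp_cong_mult_right u v a b)
    have "?ev ([Inr a, Inr b] @ v) = ?ev ([Inr (a \<otimes>\<^bsub>H\<^esub> b)] @ v)"
      using cl[OF fp_cong_mult_right(2)] hom_mult[OF assms(5) fp_cong_mult_right(3,4)] fp_cong_mult_right(3,4)
      by (simp add: fp_eval_def \<psi> K.m_assoc)
    moreover have "[Inr a, Inr b] @ v \<in> fp_words G H" "[Inr (a \<otimes>\<^bsub>H\<^esub> b)] @ v \<in> fp_words G H"
      using fp_cong_mult_right by (simp_all add: fp_words_def InlI InrI)
    ultimately show ?case using app fp_cong_mult_right(1) by metis
  qed simp_all
  have "?ev u = ?ev w" if "u \<in> fp_rel G H `` {w}" for u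
    using congr[of w u] that unfolding fp_rel_def by simp
  moreover have "w \<in> fp_rel G H `` {w}"
    using fp_cong_refl[OF assms(6)] unfolding fp_rel_def by simp
  ultimately have "?ev ` (fp_rel G H `` {w}) = {?ev w}" by blast
  then show ?thesis unfolding fp_lift_def by (simp only: the_elem_eq)
qed

section \<open>Tensor powers of the standard space and their endomorphisms\<close>

text \<open>
  A tensor in the \<open>d\<close>-th tensor power of the \<open>n\<close>-dimensional space is given by its coordinates
  with respect to the standard basis, which is indexed by the maps from \<open>{..<d}\<close> to \<open>{..<n}\<close>.
\<close>

definition multi_indices :: "nat \<Rightarrow> nat \<Rightarrow> (nat \<Rightarrow> nat) set" where
  "multi_indices n d = {..<d} \<rightarrow>\<^sub>E {..<n}"

type_synonym tensor = "(nat \<Rightarrow> nat) \<Rightarrow> complex"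

definition tensors :: "nat \<Rightarrow> nat \<Rightarrow> tensor set" where
  "tensors n d = {t. \<forall>I. I \<notin> multi_indices n d \<longrightarrow> t I = 0}"

definition pure_tensor :: "nat \<Rightarrow> nat \<Rightarrow> (nat \<Rightarrow> complex vec) \<Rightarrow> tensor" where
  "pure_tensor n d w = (\<lambda>I. if I \<in> multi_indices n d then \<Prod>i<d. w i $ I i else 0)"

definition End_tensors :: "nat \<Rightarrow> nat \<Rightarrow> (complex, tensor \<Rightarrow> tensor) module" where
  "End_tensors n d =
    \<lparr>carrier = {\<phi> \<in> tensors n d \<rightarrow>\<^sub>E tensors n d.
       (\<forall>s\<in>tensors n d. \<forall>t\<in>tensors n d. \<phi> (\<lambda>I. s I + t I) = (\<lambda>I. \<phi> s I + \<phi> t I)) \<and>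
       (\<forall>c. \<forall>t\<in>tensors n d. \<phi> (\<lambda>I. c * t I) = (\<lambda>I. c * \<phi> t I))},
     monoid.mult = compose (tensors n d),
     one = (\<lambda>t\<in>tensors n d. t),
     zero = (\<lambda>t\<in>tensors n d. \<lambda>I. 0),
     add = (\<lambda>\<phi> \<psi>. \<lambda>t\<in>tensors n d. \<lambda>I. \<phi> t I + \<psi> t I),
     smult = (\<lambda>c \<phi>. \<lambda>t\<in>tensors n d. \<lambda>I. c * \<phi> t I)\<rparr>"

definition centralizer :: "('r, 'x) monoid_scheme \<Rightarrow> 'r set \<Rightarrow> 'r set" where
  "centralizer R S = {x \<in> carrier R. \<forall>s\<in>S. x \<otimes>\<^bsub>R\<^esub> s = s \<otimes>\<^bsub>R\<^esub> x}"

text \<open>The linear extension to a basis algebra of an assignment of operators to basis elements.\<close>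

definition linear_extension ::
    "nat \<Rightarrow> nat \<Rightarrow> ('b \<Rightarrow> tensor \<Rightarrow> tensor) \<Rightarrow> ('b \<Rightarrow> complex) \<Rightarrow> tensor \<Rightarrow> tensor" where
  "linear_extension n d \<rho> a = (\<lambda>t\<in>tensors n d. \<lambda>I. \<Sum>x | a x \<noteq> 0. a x * \<rho> x t I)"

text \<open>The diagonal action of a matrix, see \<open>tensor_power_pure_tensor\<close>.\<close>

definition tensor_power :: "nat \<Rightarrow> nat \<Rightarrow> complex mat \<Rightarrow> tensor \<Rightarrow> tensor" where
  "tensor_power n d A = (\<lambda>t\<in>tensors n d. \<lambda>I. if I \<in> multi_indices n d
     then \<Sum>J\<in>multi_indices n d. (\<Prod>i<d. A $$ (I i, J i)) * t J else 0)"

lemma tensor_power_pure_tensor: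
  assumes "A \<in> carrier_mat n n" "\<And>i. i < d \<Longrightarrow> w i \<in> carrier_vec n"
  shows "tensor_power n d A (pure_tensor n d w) = pure_tensor n d (\<lambda>i. A *\<^sub>v w i)"
proof
  fix I
  have "(\<Sum>J\<in>multi_indices n d. (\<Prod>i<d. A $$ (I i, J i)) * pure_tensor n d w J) =
      (\<Prod>i<d. (A *\<^sub>v w i) $ I i)" if I: "I \<in> multi_indices n d"
  proof -
    have Ii: "I i < n" if "i < d" for i
      using I that by (auto simp: multi_indices_def)
    have "(\<Prod>i<d. (A *\<^sub>v w i) $ I i) = (\<Prod>i<d. \<Sum>j\<in>{..<n}. A $$ (I i, j) * w i $ j)"
    proof (rule prod.cong[OF refl])
      fix i assume "i \<in> {..<d}"
      then show "(A *\<^sub>v w i) $ I i = (\<Sum>j\<in>{..<n}. A $$ (I i, j) * w i $ j)"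
        using assms Ii[of i] by (auto simp: scalar_prod_def atLeast0LessThan intro!: sum.cong)
    qed
    also have "\<dots> = (\<Sum>J\<in>multi_indices n d. \<Prod>i<d. A $$ (I i, J i) * w i $ J i)"
      unfolding multi_indices_def by (intro prod_sum_PiE) auto
    finally show ?thesis
      by (auto simp: pure_tensor_def prod.distrib intro!: sum.cong)
  qed
  then show "tensor_power n d A (pure_tensor n d w) I = pure_tensor n d (\<lambda>i. A *\<^sub>v w i) I"
    by (auto simp: tensor_power_def tensors_def pure_tensor_def)
qed

section \<open>The action of the free product\<close>

definition GL :: "nat \<Rightarrow> complex mat monoid" where
  "GL n = units_of (ring_mat TYPE(complex) n ())"

definition GL_blocks :: "nat \<Rightarrow> nat \<Rightarrow> complex mat monoid" where
  "GL_blocks l m = (GL (l * m))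
     \<lparr>carrier := {A \<in> carrier (GL (l * m)).
        \<forall>i<l * m. \<forall>j<l * m. i div m \<noteq> j div m \<longrightarrow> A $$ (i, j) = 0}\<rparr>"

text \<open>The matrix sending the \<open>j\<close>-th basis vector to the one with index \<open>j + (l/k) m\<close> modulo \<open>l m\<close>.\<close>

definition shift_mat :: "nat \<Rightarrow> nat \<Rightarrow> nat \<Rightarrow> complex mat" where
  "shift_mat l k m = mat (l * m) (l * m)
     (\<lambda>(i, j). if i = (j + (l div k) * m) mod (l * m) then 1 else 0)"

lemma shift_mat_unit_vec:
  assumes "j < l * m"
  shows "shift_mat l k m *\<^sub>v unit_vec (l * m) j =
    unit_vec (l * m) ((j + (l div k) * m) mod (l * m))"
  using assms by (intro eq_vecI) (auto simp: shift_mat_def, simp add: unit_vec_def)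

definition GLZ :: "nat \<Rightarrow> nat \<Rightarrow> (complex mat + int) list set monoid" where
  "GLZ l m = free_product (GL_blocks l m) integer_group"

definition GLZ_matrix :: "nat \<Rightarrow> nat \<Rightarrow> nat \<Rightarrow> (complex mat + int) list set \<Rightarrow> complex mat" where
  "GLZ_matrix l k m =
     fp_lift (GL (l * m)) (\<lambda>A. A) (\<lambda>z::int. shift_mat l k m [^]\<^bsub>GL (l * m)\<^esub> z)"

definition GLZ_action :: "nat \<Rightarrow> nat \<Rightarrow> nat \<Rightarrow> nat \<Rightarrow>
    ((complex mat + int) list set \<Rightarrow> complex) \<Rightarrow> tensor \<Rightarrow> tensor" where
  "GLZ_action l k d m =
     linear_extension (l * m) d (\<lambda>x. tensor_power (l * m) d (GLZ_matrix l k m x))"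

section \<open>The groupoid and its algebra\<close>

definition gpd_obj :: "nat \<Rightarrow> nat \<Rightarrow> (nat \<Rightarrow> nat) set" where
  "gpd_obj l d = {..<d} \<rightarrow>\<^sub>E {..<l}"

text \<open>A morphism is a triple of its source, the underlying bijection and its target.\<close>

type_synonym gmor = "(nat \<Rightarrow> nat) \<times> (nat \<Rightarrow> nat) \<times> (nat \<Rightarrow> nat)"

definition gpd_mor :: "nat \<Rightarrow> nat \<Rightarrow> gmor set" where
  "gpd_mor l d = {(f, \<sigma>, g).
     f \<in> gpd_obj l d \<and> g \<in> gpd_obj l d \<and> \<sigma> permutes {..<d} \<and> g \<circ> \<sigma> = f}"

definition gpd_id :: "(nat \<Rightarrow> nat) \<Rightarrow> gmor" where
  "gpd_id f = (f, id, f)"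

text \<open>\<open>gpd_comp y x\<close> is \<open>y\<close> after \<open>x\<close>.\<close>

fun gpd_comp :: "gmor \<Rightarrow> gmor \<Rightarrow> gmor option" where
  "gpd_comp (g', \<tau>, h) (f, \<sigma>, g) = (if g = g' then Some (f, \<tau> \<circ> \<sigma>, h) else None)"

definition gpd_algebra :: "nat \<Rightarrow> nat \<Rightarrow> (complex, gmor \<Rightarrow> complex) module" where
  "gpd_algebra l d = basis_algebra (gpd_mor l d) (gpd_id ` gpd_obj l d) gpd_comp"

definition block_projection :: "nat \<Rightarrow> nat \<Rightarrow> (nat \<Rightarrow> nat) \<Rightarrow> tensor \<Rightarrow> tensor" where
  "block_projection d m f t = (\<lambda>I. if \<forall>i<d. I i div m = f i then t I else 0)"

text \<open>
  Project to the summand of the source and permute the tensor factors; on coordinates, moving the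
  factor \<open>i\<close> to position \<open>\<sigma> i\<close> is precomposition of multi-indices with \<open>\<sigma>\<close>.
\<close>

fun gmor_action :: "nat \<Rightarrow> nat \<Rightarrow> nat \<Rightarrow> gmor \<Rightarrow> tensor \<Rightarrow> tensor" where
  "gmor_action l d m (f, \<sigma>, g) =
     (\<lambda>t\<in>tensors (l * m) d. \<lambda>I. block_projection d m f t (I \<circ> \<sigma>))"

lemma permute_multi_index:
  assumes "\<sigma> permutes {..<d}"
  shows "I \<circ> \<sigma> \<in> multi_indices n d \<longleftrightarrow> I \<in> multi_indices n d"
proof -
  have 1: "J \<circ> \<tau> \<in> multi_indices n d" if "J \<in> multi_indices n d" "\<tau> permutes {..<d}" for J \<tau>
    using that permutes_in_image[OF that(2)] permutes_not_in[OF that(2)]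
    by (fastforce simp: multi_indices_def PiE_iff extensional_def)
  have "I = (I \<circ> \<sigma>) \<circ> inv_into UNIV \<sigma>"
    using permutes_inv_o[OF assms] by (simp add: comp_assoc)
  then show ?thesis
    using 1 assms permutes_inv[OF assms] by metis
qed

lemma gmor_action_pure_tensor:
  assumes "(f, \<sigma>, g) \<in> gpd_mor l d" "f' \<in> gpd_obj l d"
    and w: "\<And>i j. i < d \<Longrightarrow> j < l * m \<Longrightarrow> j div m \<noteq> f' i \<Longrightarrow> w i $ j = 0"
  shows "gmor_action l d m (f, \<sigma>, g) (pure_tensor (l * m) d w) =
    (if f' = f then pure_tensor (l * m) d (\<lambda>i. w (inv_into UNIV \<sigma> i)) else (\<lambda>I. 0))"
proof -
  have \<sigma>: "\<sigma> permutes {..<d}" and f: "f \<in> gpd_obj l d" and "g \<circ> \<sigma> = f"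
    using assms(1) by (auto simp: gpd_mor_def)
  have T: "pure_tensor (l * m) d w \<in> tensors (l * m) d"
    by (auto simp: tensors_def pure_tensor_def)
  have supp: "\<forall>i<d. J i div m = f' i" if "pure_tensor (l * m) d w J \<noteq> 0" for J
  proof (intro allI impI)
    fix i assume i: "i < d"
    have J: "J \<in> multi_indices (l * m) d" and "(\<Prod>i<d. w i $ J i) \<noteq> 0"
      using that by (auto simp: pure_tensor_def split: if_splits)
    then have "w i $ J i \<noteq> 0" "J i < l * m"
      using i by (auto simp: multi_indices_def)
    then show "J i div m = f' i" using w i by blast
  qed
  show ?thesis
  proof (cases "f' = f")
    case True
    have "block_projection d m f (pure_tensor (l * m) d w) (I \<circ> \<sigma>) =
        pure_tensor (l * m) d (\<lambda>i. w (inv_into UNIV \<sigma> i)) I" for I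
    proof -
      have "(\<Prod>i<d. w i $ I (\<sigma> i)) = (\<Prod>i<d. w (inv_into UNIV \<sigma> i) $ I i)"
        using prod.permute[OF \<sigma>, of "\<lambda>i. w (inv_into UNIV \<sigma> i) $ I i"] permutes_inverses(2)[OF \<sigma>]
        by (simp add: o_def)
      then have "pure_tensor (l * m) d w (I \<circ> \<sigma>) = pure_tensor (l * m) d (\<lambda>i. w (inv_into UNIV \<sigma> i)) I"
        using permute_multi_index[OF \<sigma>, of I "l * m"] by (simp add: pure_tensor_def)
      then show ?thesis
        using supp[of "I \<circ> \<sigma>"] True unfolding block_projection_def by (metis (no_types, lifting))
    qed
    then show ?thesis using True T by (simp add: fun_eq_iff)
  next
    case False
    then obtain i where i: "i < d" "f i \<noteq> f' i"
      using f assms(2) unfolding gpd_obj_def by (metis PiE_ext lessThan_iff)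
    have "block_projection d m f (pure_tensor (l * m) d w) J = 0" for J
      using supp[of J] i unfolding block_projection_def by metis
    then show ?thesis using False T by simp
  qed
qed

definition gpd_algebra_action ::
    "nat \<Rightarrow> nat \<Rightarrow> nat \<Rightarrow> (gmor \<Rightarrow> complex) \<Rightarrow> tensor \<Rightarrow> tensor" where
  "gpd_algebra_action l d m = linear_extension (l * m) d (gmor_action l d m)"

section \<open>The quotient groupoid and its algebra\<close>

definition cyc :: "nat \<Rightarrow> nat \<Rightarrow> nat" where
  "cyc l = (\<lambda>i\<in>{..<l}. (i + 1) mod l)"

definition cyc_subgroup :: "nat \<Rightarrow> nat \<Rightarrow> (nat \<Rightarrow> nat) set" where
  "cyc_subgroup l k =
     generate (BijGroup {..<l}) {cyc l [^]\<^bsub>BijGroup {..<l}\<^esub> (l div k)}"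

definition act_obj :: "nat \<Rightarrow> (nat \<Rightarrow> nat) \<Rightarrow> (nat \<Rightarrow> nat) \<Rightarrow> (nat \<Rightarrow> nat)" where
  "act_obj d h f = compose {..<d} h f"

fun act_mor :: "nat \<Rightarrow> (nat \<Rightarrow> nat) \<Rightarrow> gmor \<Rightarrow> gmor" where
  "act_mor d h (f, \<sigma>, g) = (act_obj d h f, \<sigma>, act_obj d h g)"

definition mor_orbit :: "nat \<Rightarrow> nat \<Rightarrow> nat \<Rightarrow> gmor \<Rightarrow> gmor set" where
  "mor_orbit l k d x = (\<lambda>h. act_mor d h x) ` cyc_subgroup l k"

definition quot_mor :: "nat \<Rightarrow> nat \<Rightarrow> nat \<Rightarrow> gmor set set" where
  "quot_mor l k d = mor_orbit l k d ` gpd_mor l d"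

definition quot_ids :: "nat \<Rightarrow> nat \<Rightarrow> nat \<Rightarrow> gmor set set" where
  "quot_ids l k d = (\<lambda>f. mor_orbit l k d (gpd_id f)) ` gpd_obj l d"

text \<open>
  The composites of composable representatives of two orbits form an orbit, or there are none
  when the target orbit of \<open>X\<close> is not the source orbit of \<open>Y\<close>; see \<open>quot_comp_orbit\<close> and
  \<open>quot_comp_None\<close>.
\<close>

definition quot_comp :: "gmor set \<Rightarrow> gmor set \<Rightarrow> gmor set option" where
  "quot_comp Y X =
     (let Z = {z. \<exists>y\<in>Y. \<exists>x\<in>X. gpd_comp y x = Some z} in if Z = {} then None else Some Z)"

context
  fixes l k :: nat
  assumes l: "l > 0"
begin

lemma rot_Bij: "(\<lambda>i\<in>{..<l}. (i + c) mod l) \<in> carrier (BijGroup {..<l})"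
proof -
  have "inj_on (\<lambda>i. (i + c) mod l) {..<l}"
  proof (rule inj_onI)
    fix x y assume xy: "x \<in> {..<l}" "y \<in> {..<l}" "(x + c) mod l = (y + c) mod l"
    then have "[x + c = y + c] (mod l)" by (simp add: cong_def)
    then have "[x = y] (mod l)" by (simp only: cong_add_rcancel_nat)
    then show "x = y" using xy by (simp add: cong_def)
  qed
  moreover have "(\<lambda>i. (i + c) mod l) ` {..<l} \<subseteq> {..<l}" using l by auto
  ultimately have "bij_betw (\<lambda>i. (i + c) mod l) {..<l} {..<l}"
    by (simp add: bij_betw_def endo_inj_surj)
  then show ?thesis by (simp add: BijGroup_def Bij_def)
qed

lemma rot_mult:
  "(\<lambda>i\<in>{..<l}. (i + c) mod l) \<otimes>\<^bsub>BijGroup {..<l}\<^esub> (\<lambda>i\<in>{..<l}. (i + c') mod l) =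
     (\<lambda>i\<in>{..<l}. (i + (c + c')) mod l)"
proof -
  have "compose {..<l} (\<lambda>i\<in>{..<l}. (i + c) mod l) (\<lambda>i\<in>{..<l}. (i + c') mod l) =
     (\<lambda>i\<in>{..<l}. (i + (c + c')) mod l)"
    using l by (auto simp: compose_def fun_eq_iff mod_simps add.assoc add.commute[of c' c])
  then show ?thesis using rot_Bij by (simp add: BijGroup_def)
qed

lemma rot_one: "\<one>\<^bsub>BijGroup {..<l}\<^esub> = (\<lambda>i\<in>{..<l}. (i + 0) mod l)"
  by (auto simp: BijGroup_def fun_eq_iff)

lemma cyc_pow: "cyc l [^]\<^bsub>BijGroup {..<l}\<^esub> (c::nat) = (\<lambda>i\<in>{..<l}. (i + c) mod l)"
proof (induction c)
  case 0
  then show ?case using rot_one by (simp add: nat_pow_def)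
next
  case (Suc c)
  then show ?case
    using rot_mult[of c 1] unfolding nat_pow_Suc cyc_def by (simp only: add_Suc_right add_0_right One_nat_def)
qed

lemma rot_inv:
  "\<exists>c'. inv\<^bsub>BijGroup {..<l}\<^esub> (\<lambda>i\<in>{..<l}. (i + c) mod l) = (\<lambda>i\<in>{..<l}. (i + c') mod l)"
proof -
  have "(l - c mod l) + c = (c div l + 1) * l"
    using div_mult_mod_eq[of c l] mod_less_divisor[OF l, of c] unfolding distrib_right by linarith
  then have "(\<lambda>i\<in>{..<l}. (i + ((l - c mod l) + c)) mod l) = (\<lambda>i\<in>{..<l}. (i + 0) mod l)"
    by (simp only: mod_mult_self1 add_0_right)
  then show ?thesis
    using group.inv_equality[OF group_BijGroup _ rot_Bij rot_Bij, of "l - c mod l" c]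
      rot_mult[of "l - c mod l" c] rot_one by metis
qed

lemma cyc_subgroup_rot:
  assumes "h \<in> cyc_subgroup l k"
  obtains c where "h = (\<lambda>i\<in>{..<l}. (i + c) mod l)"
proof -
  have "\<exists>c. h = (\<lambda>i\<in>{..<l}. (i + c) mod l)"
    using assms unfolding cyc_subgroup_def cyc_pow
  proof (induction rule: generate.induct)
    case one
    then show ?case using rot_one by metis
  next
    case (incl h)
    then show ?case by auto
  next
    case (inv h)
    then show ?case using rot_inv by (simp only: singleton_iff)
  next
    case (eng h1 h2)
    then show ?case using rot_mult by metis
  qed
  then show thesis using that by blast
qed

lemma cyc_subgroup_subgroup: "subgroup (cyc_subgroup l k) (BijGroup {..<l})"
  unfolding cyc_subgroup_def cyc_pow
  by (rule group.generate_is_subgroup[OF group_BijGroup]) (use rot_Bij in auto)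

lemma cyc_subgroup_free:
  assumes "h \<in> cyc_subgroup l k" "h' \<in> cyc_subgroup l k" "f \<in> gpd_obj l d" "d > 0"
    and eq: "act_obj d h f = act_obj d h' f"
  shows "h = h'"
proof -
  obtain c where c: "h = (\<lambda>i\<in>{..<l}. (i + c) mod l)" using cyc_subgroup_rot[OF assms(1)] .
  obtain c' where c': "h' = (\<lambda>i\<in>{..<l}. (i + c') mod l)" using cyc_subgroup_rot[OF assms(2)] .
  have f0: "f 0 < l" using assms(3,4) by (auto simp: gpd_obj_def)
  have "h (f 0) = h' (f 0)"
    using fun_cong[OF eq, of 0] assms(4) by (simp add: act_obj_def compose_def)
  then have "[f 0 + c = f 0 + c'] (mod l)"
    using f0 by (simp add: c c' cong_def)
  then have "[c = c'] (mod l)" by (simp only: cong_add_lcancel_nat)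
  then have "[i + c = i + c'] (mod l)" for i by (simp only: cong_add_lcancel_nat)
  then have "(i + c) mod l = (i + c') mod l" for i by (simp only: cong_def)
  then show ?thesis by (simp add: c c')
qed

lemma quot_comp_orbit:
  assumes "d > 0" "(f, \<sigma>, g) \<in> gpd_mor l d" "(g, \<tau>, h) \<in> gpd_mor l d"
  shows "quot_comp (mor_orbit l k d (g, \<tau>, h)) (mor_orbit l k d (f, \<sigma>, g)) =
    Some (mor_orbit l k d (f, \<tau> \<circ> \<sigma>, h))"
proof -
  have g: "g \<in> gpd_obj l d" using assms by (auto simp: gpd_mor_def)
  have "{z. \<exists>y\<in>mor_orbit l k d (g, \<tau>, h). \<exists>x\<in>mor_orbit l k d (f, \<sigma>, g). gpd_comp y x = Some z} =
      mor_orbit l k d (f, \<tau> \<circ> \<sigma>, h)" (is "?Z = _")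
  proof (intro equalityI subsetI)
    fix z assume "z \<in> ?Z"
    then obtain a b where ab: "a \<in> cyc_subgroup l k" "b \<in> cyc_subgroup l k"
      and z: "gpd_comp (act_mor d a (g, \<tau>, h)) (act_mor d b (f, \<sigma>, g)) = Some z"
      by (auto simp: mor_orbit_def)
    have "act_obj d b g = act_obj d a g" using z by (auto split: if_splits)
    then have "b = a" using cyc_subgroup_free ab g assms(1) by blast
    then show "z \<in> mor_orbit l k d (f, \<tau> \<circ> \<sigma>, h)" using z ab by (auto simp: mor_orbit_def)
  next
    fix z assume "z \<in> mor_orbit l k d (f, \<tau> \<circ> \<sigma>, h)"
    then show "z \<in> ?Z" by (fastforce simp: mor_orbit_def)
  qed
  moreover have "mor_orbit l k d (f, \<tau> \<circ> \<sigma>, h) \<noteq> {}"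
    using subgroup.one_closed[OF cyc_subgroup_subgroup] by (auto simp: mor_orbit_def)
  ultimately show ?thesis by (simp add: quot_comp_def)
qed

lemma quot_comp_None:
  assumes "(f, \<sigma>, g) \<in> gpd_mor l d" "(g', \<tau>, h) \<in> gpd_mor l d"
    and "g' \<notin> (\<lambda>a. act_obj d a g) ` cyc_subgroup l k"
  shows "quot_comp (mor_orbit l k d (g', \<tau>, h)) (mor_orbit l k d (f, \<sigma>, g)) = None"
proof -
  interpret B: group "BijGroup {..<l}" by (rule group_BijGroup)
  have gg: "g \<in> gpd_obj l d" "g' \<in> gpd_obj l d" using assms by (auto simp: gpd_mor_def)
  have False if ab: "a \<in> cyc_subgroup l k" "b \<in> cyc_subgroup l k"
    and eq: "act_obj d b g = act_obj d a g'" for a b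
  proof -
    obtain c where c: "c \<in> cyc_subgroup l k"
      and inv: "c \<otimes>\<^bsub>BijGroup {..<l}\<^esub> a = \<one>\<^bsub>BijGroup {..<l}\<^esub>"
      using subgroup.m_inv_closed[OF cyc_subgroup_subgroup ab(1)]
        B.l_inv[OF subgroup.mem_carrier[OF cyc_subgroup_subgroup ab(1)]] by blast
    have Bij: "x \<in> Bij {..<l}" if "x \<in> cyc_subgroup l k" for x
      using subgroup.mem_carrier[OF cyc_subgroup_subgroup that] by (simp add: BijGroup_def)
    have ca: "c (a i) = i" if "i < l" for i
    proof -
      have "compose {..<l} c a = (\<lambda>x\<in>{..<l}. x)"
        using inv Bij[OF c] Bij[OF ab(1)] by (simp add: BijGroup_def)
      from fun_cong[OF this, of i] show ?thesis using that by (simp add: compose_def)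
    qed
    have cb: "c \<otimes>\<^bsub>BijGroup {..<l}\<^esub> b \<in> cyc_subgroup l k"
      using subgroup.m_closed[OF cyc_subgroup_subgroup c ab(2)] .
    have "c \<otimes>\<^bsub>BijGroup {..<l}\<^esub> b = compose {..<l} c b"
      using Bij[OF c] Bij[OF ab(2)] by (simp add: BijGroup_def)
    moreover have "g' = act_obj d (compose {..<l} c b) g"
    proof
      fix i
      show "g' i = act_obj d (compose {..<l} c b) g i"
      proof (cases "i < d")
        case True
        have "g i < l" "g' i < l" using gg True by (auto simp: gpd_obj_def)
        moreover have "b (g i) = a (g' i)"
          using fun_cong[OF eq, of i] True by (simp add: act_obj_def compose_def)
        ultimately show ?thesis using True ca[of "g' i"] by (simp add: act_obj_def compose_def)
      next
        case False
        then show ?thesis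
          using gg by (auto simp: act_obj_def compose_def gpd_obj_def PiE_iff extensional_def)
      qed
    qed
    ultimately show False using assms(3) cb by auto
  qed
  then have "{z. \<exists>y\<in>mor_orbit l k d (g', \<tau>, h). \<exists>x\<in>mor_orbit l k d (f, \<sigma>, g).
      gpd_comp y x = Some z} = {}"
    by (fastforce simp: mor_orbit_def split: if_splits)
  then show ?thesis by (simp add: quot_comp_def)
qed

end

definition quot_algebra :: "nat \<Rightarrow> nat \<Rightarrow> nat \<Rightarrow> (complex, gmor set \<Rightarrow> complex) module" where
  "quot_algebra l k d = basis_algebra (quot_mor l k d) (quot_ids l k d) quot_comp"

text \<open>
  The homomorphism sending the basis element of an orbit to the sum of the members of the orbit.
\<close>

definition quot_embedding :: "(gmor set \<Rightarrow> complex) \<Rightarrow> gmor \<Rightarrow> complex" where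
  "quot_embedding a = (\<lambda>x. \<Sum>X | a X \<noteq> 0 \<and> x \<in> X. a X)"

definition quot_algebra_action ::
    "nat \<Rightarrow> nat \<Rightarrow> nat \<Rightarrow> (gmor set \<Rightarrow> complex) \<Rightarrow> tensor \<Rightarrow> tensor" where
  "quot_algebra_action l d m a = gpd_algebra_action l d m (quot_embedding a)"

end

theory Submission
  imports Defs "Jordan_Normal_Form.Spectral_Radius"
begin

text \<open>
  Operators on tensors are matrices \<open>Y I J\<close> indexed by multi-indices. Testing against the orbit
  sums shows that \<open>Y\<close> centralizes the groupoid algebra iff it is equivariant: invariant under
  permuting the entries of \<open>I\<close> and \<open>J\<close> simultaneously, and zero unless the block types of \<open>I\<close> and
  \<open>J\<close> lie in one orbit of the cyclic group. Such \<open>Y\<close> are combinations of the symmetrized matrix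
  units \<open>\<Sum>\<sigma>. E (I \<circ> \<sigma>) (J \<circ> \<sigma>)\<close>, which polarization writes as combinations of tensor powers
  \<open>h \<otimes> \<dots> \<otimes> h\<close> with \<open>h\<close> shifting the blocks by a fixed amount; interpolation along
  \<open>h - e S\<^sup>z\<close> replaces \<open>h\<close> by group elements.
  Conversely, let \<open>X\<close> commute with the group. Since \<open>m \<ge> d\<close>, every block type \<open>f\<close> is the type of a
  multi-index \<open>J\<close> with distinct entries. Then \<open>E\<^bsub>I\<^esub>\<close> is the image of \<open>E\<^bsub>J\<^esub>\<close> under the symmetrized unit
  of \<open>I\<close> and \<open>J\<close>, for all \<open>I\<close> whose type lies in the orbit of \<open>f\<close>, so \<open>X\<close> is determined there by
  the column \<open>J\<close> and equals a combination of permutations whose coefficients depend on the orbit only.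
\<close>

section \<open>Operators on tensors as matrices indexed by multi-indices\<close>

text \<open>Restricting to \<open>tensors n d\<close> and returning 0 off
  \<open>multi_indices n d\<close> makes the operator a literal element of
  \<open>End_tensors n d\<close>, whose maps are extensional. Only the entries of \<open>Y\<close>
  at multi-indices influence it.\<close>

definition tensor_op ::
    "nat \<Rightarrow> nat \<Rightarrow> ((nat \<Rightarrow> nat) \<Rightarrow> (nat \<Rightarrow> nat) \<Rightarrow> complex) \<Rightarrow> tensor \<Rightarrow> tensor" where
  "tensor_op n d Y = (\<lambda>t\<in>tensors n d. \<lambda>I. if I \<in> multi_indices n d
     then \<Sum>J\<in>multi_indices n d. Y I J * t J else 0)"

definition basis_tensor :: "(nat \<Rightarrow> nat) \<Rightarrow> tensor" where
  "basis_tensor J = (\<lambda>I. if I = J then 1 else 0)"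

lemma finite_multi_indices [simp]: "finite (multi_indices n d)"
  by (simp add: multi_indices_def finite_PiE)

lemma basis_tensor_in_tensors: "J \<in> multi_indices n d \<Longrightarrow> basis_tensor J \<in> tensors n d"
  by (auto simp: basis_tensor_def tensors_def)

lemma tensor_op_basis_tensor:
  assumes "I \<in> multi_indices n d" "J \<in> multi_indices n d"
  shows "tensor_op n d Y (basis_tensor J) I = Y I J"
  using assms by (simp add: tensor_op_def basis_tensor_in_tensors)
    (simp add: basis_tensor_def if_distrib[of "(*) _"] cong: if_cong)

lemma tensor_op_cong:
  assumes "\<And>I J. I \<in> multi_indices n d \<Longrightarrow> J \<in> multi_indices n d \<Longrightarrow> X I J = Y I J"
  shows "tensor_op n d X = tensor_op n d Y"
  using assms by (auto simp: tensor_op_def fun_eq_iff restrict_def intro!: sum.cong)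

lemma tensor_op_eq_iff:
  "tensor_op n d X = tensor_op n d Y \<longleftrightarrow>
    (\<forall>I\<in>multi_indices n d. \<forall>J\<in>multi_indices n d. X I J = Y I J)"
  using tensor_op_cong tensor_op_basis_tensor by metis

lemma tensor_op_in_End: "tensor_op n d Y \<in> carrier (End_tensors n d)"
proof -
  have closed: "(\<lambda>I. s I + t I) \<in> tensors n d" "(\<lambda>I. c * t I) \<in> tensors n d"
    if "s \<in> tensors n d" "t \<in> tensors n d" for s t c
    using that by (auto simp: tensors_def)
  have "tensor_op n d Y \<in> tensors n d \<rightarrow>\<^sub>E tensors n d"
    unfolding tensor_op_def by (auto simp: tensors_def)
  moreover have "tensor_op n d Y (\<lambda>I. s I + t I) = (\<lambda>I. tensor_op n d Y s I + tensor_op n d Y t I)"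
    if "s \<in> tensors n d" "t \<in> tensors n d" for s t
    using that closed(1)[OF that] by (simp add: tensor_op_def fun_eq_iff sum.distrib distrib_left)
  moreover have "tensor_op n d Y (\<lambda>I. c * t I) = (\<lambda>I. c * tensor_op n d Y t I)"
    if "t \<in> tensors n d" for t c
    using that closed(2)[OF that that]
    by (simp add: tensor_op_def fun_eq_iff sum_distrib_left mult.left_commute)
  ultimately show ?thesis by (simp add: End_tensors_def)
qed

text \<open>The columns are the images of the basis tensors. Every tensor is a finite combination of
  these, so linearity recovers the whole operator.\<close>

lemma End_tensors_obtain_matrix:
  assumes "\<phi> \<in> carrier (End_tensors n d)"
  obtains Y where "\<phi> = tensor_op n d Y"
proof -
  let ?M = "multi_indices n d"
  have \<phi>: "\<phi> \<in> tensors n d \<rightarrow>\<^sub>E tensors n d"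
    and add: "\<And>s t. s \<in> tensors n d \<Longrightarrow> t \<in> tensors n d \<Longrightarrow> \<phi> (\<lambda>I. s I + t I) = (\<lambda>I. \<phi> s I + \<phi> t I)"
    and smult: "\<And>c t. t \<in> tensors n d \<Longrightarrow> \<phi> (\<lambda>I. c * t I) = (\<lambda>I. c * \<phi> t I)"
    using assms by (auto simp: End_tensors_def)
  have zero: "\<phi> (\<lambda>I. 0) = (\<lambda>I. 0)"
    using smult[of "\<lambda>I. 0" 0] by (simp add: tensors_def)
  have sum: "\<phi> (\<lambda>I. \<Sum>J\<in>F. t J * basis_tensor J I) = (\<lambda>I. \<Sum>J\<in>F. t J * \<phi> (basis_tensor J) I)"
    if "finite F" "F \<subseteq> ?M" for F t
    using that
  proof (induction F rule: finite_induct)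
    case empty
    then show ?case by (simp add: zero)
  next
    case (insert x F)
    have F: "(\<lambda>I. \<Sum>J\<in>F. t J * basis_tensor J I) \<in> tensors n d"
      using insert.prems by (auto simp: tensors_def basis_tensor_def intro!: sum.neutral)
    have x: "basis_tensor x \<in> tensors n d"
      using insert.prems by (simp add: basis_tensor_in_tensors)
    then have tx: "(\<lambda>I. t x * basis_tensor x I) \<in> tensors n d"
      by (auto simp: tensors_def)
    have IH: "\<phi> (\<lambda>I. \<Sum>J\<in>F. t J * basis_tensor J I) = (\<lambda>I. \<Sum>J\<in>F. t J * \<phi> (basis_tensor J) I)"
      using insert.IH insert.prems by blast
    show ?case
      unfolding sum.insert[OF insert.hyps(1,2)] add[OF tx F] smult[OF x] IH ..
  qed
  have "\<phi> t = tensor_op n d (\<lambda>I J. \<phi> (basis_tensor J) I) t" for t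
  proof (cases "t \<in> tensors n d")
    case True
    have "t I = (\<Sum>J\<in>?M. t J * basis_tensor J I)" for I
    proof -
      have "(\<Sum>J\<in>?M. t J * basis_tensor J I) = (\<Sum>J\<in>?M. if J = I then t J else 0)"
        by (intro sum.cong) (auto simp: basis_tensor_def)
      then show ?thesis using True by (simp add: tensors_def)
    qed
    then have "t = (\<lambda>I. \<Sum>J\<in>?M. t J * basis_tensor J I)" by (rule ext)
    then have "\<phi> t = (\<lambda>I. \<Sum>J\<in>?M. t J * \<phi> (basis_tensor J) I)"
      using sum[of ?M t, OF finite_multi_indices subset_refl] by (rule trans[OF arg_cong[where f = \<phi>]])
    moreover have "\<phi> t I = 0" if "I \<notin> ?M" for I
      using \<phi> True that by (auto simp: tensors_def dest: PiE_mem)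
    ultimately show ?thesis
      using True by (simp add: tensor_op_def fun_eq_iff mult.commute)
  next
    \<comment> \<open>Off \<open>tensors n d\<close> both sides are \<open>undefined\<close>, by
      extensionality.\<close>
    case False
    then show ?thesis using \<phi> by (auto simp: tensor_op_def)
  qed
  then show thesis using that by blast
qed

lemma tensor_op_mult:
  "tensor_op n d X \<otimes>\<^bsub>End_tensors n d\<^esub> tensor_op n d Y =
    tensor_op n d (\<lambda>I J. \<Sum>K\<in>multi_indices n d. X I K * Y K J)"
proof
  fix t
  have "(\<Sum>K\<in>multi_indices n d. X I K * (\<Sum>J\<in>multi_indices n d. Y K J * t J)) =
      (\<Sum>J\<in>multi_indices n d. (\<Sum>K\<in>multi_indices n d. X I K * Y K J) * t J)" for I
    unfolding sum_distrib_left sum_distrib_right mult.assoc by (rule sum.swap)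
  moreover have "(\<lambda>I. if I \<in> multi_indices n d then \<Sum>J\<in>multi_indices n d. Y I J * t J else 0)
      \<in> tensors n d"
    by (simp add: tensors_def)
  ultimately show "(tensor_op n d X \<otimes>\<^bsub>End_tensors n d\<^esub> tensor_op n d Y) t =
      tensor_op n d (\<lambda>I J. \<Sum>K\<in>multi_indices n d. X I K * Y K J) t"
    by (auto simp: End_tensors_def tensor_op_def compose_def cong: if_cong)
qed

lemma tensor_op_commute_iff:
  "tensor_op n d X \<otimes>\<^bsub>End_tensors n d\<^esub> tensor_op n d Y =
     tensor_op n d Y \<otimes>\<^bsub>End_tensors n d\<^esub> tensor_op n d X \<longleftrightarrow>
   (\<forall>I\<in>multi_indices n d. \<forall>J\<in>multi_indices n d.
     (\<Sum>K\<in>multi_indices n d. X I K * Y K J) = (\<Sum>K\<in>multi_indices n d. Y I K * X K J))"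
  by (simp add: tensor_op_mult tensor_op_eq_iff)

lemma tensor_power_eq_tensor_op:
  "tensor_power n d A = tensor_op n d (\<lambda>I J. \<Prod>i<d. A $$ (I i, J i))"
  by (simp add: tensor_power_def tensor_op_def)

lemma finite_permutes: "finite {\<sigma>. \<sigma> permutes {..<d::nat}}"
  by (rule finite_permutations) simp

section \<open>Polarization and interpolation\<close>

text \<open>
  Expanding the products over all maps \<open>F\<close> from \<open>{..<d}\<close> to itself, inclusion-exclusion leaves
  only the surjective ones.
\<close>

lemma polarization:
  fixes a :: "nat \<Rightarrow> nat \<Rightarrow> complex"
  shows "(\<Sum>S\<in>Pow {..<d}. (-1) ^ (d - card S) * (\<Prod>i<d. \<Sum>j\<in>S. a j i)) =
    (\<Sum>\<sigma> | \<sigma> permutes {..<d}. \<Prod>i<d. a (\<sigma> i) i)"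
proof -
  let ?D = "{..<d}"
  let ?F = "?D \<rightarrow>\<^sub>E ?D"
  have finF: "finite ?F" by (simp add: finite_PiE)
  \<comment> \<open>The product over \<open>?D - S\<close> is the indicator that \<open>F\<close>
    takes its values in \<open>S\<close>. Written over the complement of \<open>S\<close>, it has
    the shape of one term in the expansion of a product of differences.\<close>
  have expand: "(\<Prod>i<d. \<Sum>j\<in>S. a j i) =
      (\<Sum>F\<in>?F. (\<Prod>i<d. a (F i) i) * (\<Prod>x\<in>?D - S. of_bool (x \<notin> F ` ?D)))" if "S \<subseteq> ?D" for S
  proof -
    have fin: "finite S" using that finite_subset by blast
    have "(\<Prod>i<d. \<Sum>j\<in>S. a j i) = (\<Sum>F\<in>?D \<rightarrow>\<^sub>E S. \<Prod>i<d. a (F i) i)"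
      using fin by (intro prod_sum_PiE) auto
    also have "\<dots> = (\<Sum>F\<in>?F. (\<Prod>i<d. a (F i) i) * (\<Prod>x\<in>?D - S. of_bool (x \<notin> F ` ?D)))"
    proof (rule sum.mono_neutral_cong_left[OF finF])
      show "?D \<rightarrow>\<^sub>E S \<subseteq> ?F" using that by (auto simp: PiE_iff)
      show "\<forall>F\<in>?F - (?D \<rightarrow>\<^sub>E S). (\<Prod>i<d. a (F i) i) * (\<Prod>x\<in>?D - S. of_bool (x \<notin> F ` ?D)) = 0"
      proof
        fix F assume F: "F \<in> ?F - (?D \<rightarrow>\<^sub>E S)"
        then obtain i where "i < d" "F i \<notin> S" by (auto simp: PiE_iff)
        moreover have "F i < d" using F \<open>i < d\<close> by auto
        ultimately have "\<exists>x\<in>?D - S. (of_bool (x \<notin> F ` ?D) :: complex) = 0"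
          by (intro bexI[of _ "F i"]) auto
        then have "(\<Prod>x\<in>?D - S. of_bool (x \<notin> F ` ?D)) = (0::complex)"
          by (subst prod_zero_iff) auto
        then show "(\<Prod>i<d. a (F i) i) * (\<Prod>x\<in>?D - S. of_bool (x \<notin> F ` ?D)) = 0" by simp
      qed
      show "(\<Prod>i<d. a (F i) i) = (\<Prod>i<d. a (F i) i) * (\<Prod>x\<in>?D - S. of_bool (x \<notin> F ` ?D))"
        if "F \<in> ?D \<rightarrow>\<^sub>E S" for F
      proof -
        have "(\<Prod>x\<in>?D - S. of_bool (x \<notin> F ` ?D)) = (1::complex)"
          using that by (intro prod.neutral) auto
        then show ?thesis by simp
      qed
    qed
    finally show ?thesis .
  qed
  have alt: "(\<Sum>S\<in>Pow ?D. (-1) ^ (d - card S) * (\<Prod>x\<in>?D - S. of_bool (x \<notin> F ` ?D))) =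
      (of_bool (?D \<subseteq> F ` ?D) :: complex)" for F
  proof -
    have "(\<Sum>S\<in>Pow ?D. (-1) ^ (d - card S) * (\<Prod>x\<in>?D - S. of_bool (x \<notin> F ` ?D))) =
        (\<Prod>x<d. 1 - (of_bool (x \<notin> F ` ?D) :: complex))"
      by (subst prod_diff_conv_sum') simp_all
    also have "\<dots> = of_bool (?D \<subseteq> F ` ?D)"
      by (cases "?D \<subseteq> F ` ?D") (auto intro!: prod.neutral)
    finally show ?thesis .
  qed
  have "(\<Sum>S\<in>Pow ?D. (-1) ^ (d - card S) * (\<Prod>i<d. \<Sum>j\<in>S. a j i)) =
      (\<Sum>S\<in>Pow ?D. \<Sum>F\<in>?F. (\<Prod>i<d. a (F i) i) *
        ((-1) ^ (d - card S) * (\<Prod>x\<in>?D - S. of_bool (x \<notin> F ` ?D))))"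
    by (intro sum.cong) (auto simp: expand sum_distrib_left mult.left_commute)
  also have "\<dots> = (\<Sum>F\<in>?F. (\<Prod>i<d. a (F i) i) * of_bool (?D \<subseteq> F ` ?D))"
    by (subst sum.swap) (simp add: alt flip: sum_distrib_left)
  also have "\<dots> = (\<Sum>F | F \<in> ?F \<and> ?D \<subseteq> F ` ?D. \<Prod>i<d. a (F i) i)"
    by (rule sum.mono_neutral_cong_right[OF finF]) auto
  also have "\<dots> = (\<Sum>\<sigma> | \<sigma> permutes {..<d}. \<Prod>i<d. a (\<sigma> i) i)"
  proof (rule sum.reindex_bij_witness[where i = "\<lambda>\<sigma>. restrict \<sigma> ?D"
        and j = "\<lambda>F x. if x \<in> ?D then F x else x"])
    fix F assume F: "F \<in> {F. F \<in> ?F \<and> ?D \<subseteq> F ` ?D}"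
    let ?p = "\<lambda>x. if x \<in> ?D then F x else x"
    \<comment> \<open>A surjection of a finite set onto itself is a bijection; \<open>?p\<close>
      extends it by the identity, as \<open>permutes\<close> requires.\<close>
    have "F ` ?D = ?D" using F by auto
    then have "bij_betw F ?D ?D" by (simp add: bij_betw_def finite_surj_inj)
    then have "bij_betw ?p ?D ?D" by (subst bij_betw_cong[of _ _ F]) auto
    then show "?p \<in> {\<sigma>. \<sigma> permutes ?D}" by (intro CollectI bij_imp_permutes) auto
    show "restrict ?p ?D = F" using F by (auto simp: fun_eq_iff PiE_iff extensional_def)
    show "(\<Prod>i<d. a (?p i) i) = (\<Prod>i<d. a (F i) i)" by (intro prod.cong) auto
  next
    fix \<sigma> assume "\<sigma> \<in> {\<sigma>. \<sigma> permutes ?D}"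
    then have \<sigma>: "\<sigma> permutes ?D" by simp
    have "restrict \<sigma> ?D ` ?D = ?D" using permutes_image[OF \<sigma>] by auto
    then show "restrict \<sigma> ?D \<in> {F. F \<in> ?F \<and> ?D \<subseteq> F ` ?D}"
      using permutes_in_image[OF \<sigma>] by auto
    show "(\<lambda>x. if x \<in> ?D then restrict \<sigma> ?D x else x) = \<sigma>"
      using permutes_not_in[OF \<sigma>] by auto
  qed
  finally show ?thesis .
qed

text \<open>Lagrange interpolation at \<open>d + 1\<close> nodes. The weights \<open>c\<close>
  depend on \<open>T\<close> and \<open>x\<close> but not on \<open>p\<close>, so one choice serves
  all matrix entries at once.\<close>

lemma lagrange_functional:
  fixes T :: "'a::field set"
  assumes "card T = Suc d"
  obtains c where "\<And>p. degree p \<le> d \<Longrightarrow> poly p x = (\<Sum>t\<in>T. c t * poly p t)"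
proof -
  have fin: "finite T" using assms card.infinite by fastforce
  \<comment> \<open>The Lagrange basis polynomial of the node \<open>t\<close>: 1 at
    \<open>t\<close> and 0 at the other nodes.\<close>
  define L where "L t = (\<Prod>u\<in>T - {t}. smult (1 / (t - u)) [:-u, 1:])" for t
  have degL: "degree (L t) \<le> d" if "t \<in> T" for t
  proof -
    have "degree (L t) \<le> (\<Sum>u\<in>T - {t}. degree (smult (1 / (t - u)) [:-u, 1:]))"
      unfolding L_def by (rule order.trans[OF degree_prod_sum_le]) (use fin in auto)
    also have "\<dots> \<le> (\<Sum>u\<in>T - {t}. 1)" by (intro sum_mono) (auto simp: degree_smult_le)
    also have "\<dots> = d" using assms that fin by simp
    finally show ?thesis .
  qed
  have polyL: "poly (L t) s = (if s = t then 1 else 0)" if "s \<in> T" "t \<in> T" for s t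
  proof (cases "s = t")
    case True
    have "poly (smult (1 / (t - u)) [:-u, 1:]) t = 1" if "u \<in> T - {t}" for u
      using that by (auto simp flip: diff_divide_distrib)
    then show ?thesis using True by (simp add: L_def poly_prod)
  next
    case False
    then have "\<exists>u\<in>T - {t}. poly (smult (1 / (t - u)) [:-u, 1:]) s = 0"
      using that by (intro bexI[of _ s]) simp_all
    then have "poly (L t) s = 0" unfolding L_def poly_prod using fin by (subst prod_zero_iff) auto
    then show ?thesis using False by simp
  qed
  show thesis
  proof (rule that[of "\<lambda>t. poly (L t) x"])
    fix p :: "'a poly" assume p: "degree p \<le> d"
    \<comment> \<open>The interpolation error has degree at most \<open>d\<close> and vanishes at
      \<open>d + 1\<close> points, hence is zero.\<close>
    define q where "q = p - (\<Sum>t\<in>T. smult (poly p t) (L t))"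
    have "degree q \<le> d"
      unfolding q_def using p degL by (intro degree_diff_le degree_sum_le fin)
        (auto intro: order.trans[OF degree_smult_le])
    moreover have "poly q s = 0" if "s \<in> T" for s
    proof -
      have "(\<Sum>t\<in>T. poly p t * poly (L t) s) = (\<Sum>t\<in>T. if t = s then poly p t else 0)"
        using that by (intro sum.cong) (auto simp: polyL)
      then show ?thesis using that fin by (simp add: q_def poly_sum)
    qed
    then have "T \<subseteq> {s. poly q s = 0}" by auto
    ultimately have "q = 0"
      using poly_roots_degree[of q] poly_roots_finite[of q] card_mono[of "{s. poly q s = 0}" T] assms
      by fastforce
    then have "p = (\<Sum>t\<in>T. smult (poly p t) (L t))" by (simp add: q_def)
    from arg_cong[OF this, of "\<lambda>p. poly p x"]
    show "poly p x = (\<Sum>t\<in>T. poly (L t) x * poly p t)" by (simp add: poly_sum mult.commute)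
  qed
qed

section \<open>The rotation subgroup\<close>

text \<open>Integer shifts make inverses and integer powers of rotations plain arithmetic in
  \<open>z\<close>; the restriction matches the extensional elements of
  \<open>BijGroup\<close>.\<close>

definition rotation :: "nat \<Rightarrow> int \<Rightarrow> nat \<Rightarrow> nat" where
  "rotation l z = (\<lambda>i\<in>{..<l}. nat ((int i + z) mod int l))"

text \<open>A subgroup generated by one element consists of its integer powers, and powers of a
  rotation multiply the shift.\<close>

lemma cyc_subgroup_eq:
  assumes "l > 0"
  shows "cyc_subgroup l k = range (\<lambda>z. rotation l (z * int (l div k)))"
proof -
  let ?B = "BijGroup {..<l}"
  interpret B: group ?B by (rule group_BijGroup)
  \<comment> \<open>Replacing \<open>z\<close> by its natural residue gives the maps treated by
    \<open>rot_Bij\<close> and \<open>cyc_pow\<close>.\<close>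
  have eq: "rotation l z = (\<lambda>i\<in>{..<l}. (i + nat (z mod int l)) mod l)" for z
  proof -
    have "int ((i + nat (z mod int l)) mod l) = (int i + z) mod int l" for i
      using assms by (simp add: zmod_int mod_simps)
    then have "(i + nat (z mod int l)) mod l = nat ((int i + z) mod int l)" for i
      by (metis nat_int)
    then show ?thesis by (simp add: rotation_def)
  qed
  have closed: "rotation l z \<in> carrier ?B" for z
    unfolding eq by (rule rot_Bij[OF assms])
  have mult: "rotation l z \<otimes>\<^bsub>?B\<^esub> rotation l w = rotation l (z + w)" for z w
  proof -
    have "compose {..<l} (rotation l z) (rotation l w) = rotation l (z + w)"
      using assms by (auto simp: compose_def rotation_def fun_eq_iff mod_simps ac_simps nat_less_iff)
    then show ?thesis using closed by (simp add: BijGroup_def)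
  qed
  have one: "\<one>\<^bsub>?B\<^esub> = rotation l 0"
    by (auto simp: BijGroup_def rotation_def fun_eq_iff)
  have npow: "rotation l w [^]\<^bsub>?B\<^esub> (c::nat) = rotation l (int c * w)" for w c
    by (induction c) (simp_all add: one mult distrib_right add.commute)
  have ipow: "rotation l w [^]\<^bsub>?B\<^esub> (z::int) = rotation l (z * w)" for w z
  proof (cases z rule: int_cases2)
    case (nonneg c)
    then show ?thesis by (simp add: int_pow_int npow)
  next
    case (nonpos c)
    have "inv\<^bsub>?B\<^esub> rotation l (int c * w) = rotation l (- int c * w)"
      by (rule B.inv_equality) (simp_all add: mult one closed)
    then show ?thesis using nonpos B.int_pow_neg_int[OF closed] by (simp add: npow)
  qed
  have "cyc l [^]\<^bsub>?B\<^esub> (l div k) = rotation l (int (l div k))"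
    unfolding cyc_pow[OF assms] eq by (auto simp: fun_eq_iff zmod_int[symmetric] mod_simps)
  then show ?thesis
    unfolding cyc_subgroup_def using B.generate_pow[OF closed] by (auto simp: ipow)
qed

text \<open>Objects are extensional, so only positions below \<open>d\<close> need comparing. One
  shift \<open>z\<close> must serve all of them; in this form orbits can be matched with degrees of
  matrices.\<close>

lemma in_orbit_iff_cong:
  assumes "l > 0" "f \<in> gpd_obj l d" "g \<in> gpd_obj l d"
  shows "(\<exists>h\<in>cyc_subgroup l k. f = act_obj d h g) \<longleftrightarrow>
    (\<exists>z. \<forall>i<d. [int (f i) = int (g i) + z * int (l div k)] (mod int l))"
proof -
  have lt: "f i < l" "g i < l" if "i < d" for i
    using assms that by (auto simp: gpd_obj_def)
  have "f = act_obj d (rotation l w) g \<longleftrightarrow> (\<forall>i<d. [int (f i) = int (g i) + w] (mod int l))" for w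
  proof -
    have "f = act_obj d (rotation l w) g \<longleftrightarrow> (\<forall>i<d. f i = rotation l w (g i))"
      using assms by (auto simp: gpd_obj_def act_obj_def compose_def fun_eq_iff PiE_iff extensional_def)
    also have "\<dots> \<longleftrightarrow> (\<forall>i<d. int (f i) = (int (g i) + w) mod int l)"
      using lt assms(1) by (auto simp: rotation_def)
    finally show ?thesis using lt by (auto simp: cong_def)
  qed
  then show ?thesis by (simp add: cyc_subgroup_eq[OF assms(1)])
qed

section \<open>Block-graded matrices\<close>

lemma carrier_GL_iff:
  "A \<in> carrier (GL n) \<longleftrightarrow> A \<in> carrier_mat n n \<and> (\<exists>B\<in>carrier_mat n n. B * A = 1\<^sub>m n \<and> A * B = 1\<^sub>m n)"
  by (auto simp: GL_def units_of_def Units_def ring_mat_simps)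

lemma GL_simps: "A \<otimes>\<^bsub>GL n\<^esub> B = A * B" "\<one>\<^bsub>GL n\<^esub> = 1\<^sub>m n"
  by (simp_all add: GL_def units_of_def ring_mat_simps)

lemma group_GL: "group (GL n)"
proof -
  interpret ring "ring_mat TYPE(complex) n ()" by (rule ring_mat)
  show ?thesis unfolding GL_def by (rule units_group)
qed

locale block_setting =
  fixes l k m d :: nat
  assumes l_pos: "l > 0" and m_pos: "m > 0" and m_ge: "d \<le> m"
begin

abbreviation n where "n \<equiv> l * m"
abbreviation r where "r \<equiv> l div k"
abbreviation S where "S \<equiv> shift_mat l k m"

text \<open>Homogeneity of degree \<open>z\<close>: block \<open>b\<close> is sent into block
  \<open>b + z * r\<close> modulo \<open>l\<close>. Degrees are integers so that they add and negate
  freely; they are not unique, the zero matrix having every degree.\<close>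

definition graded :: "int \<Rightarrow> complex mat \<Rightarrow> bool" where
  "graded z A \<longleftrightarrow> A \<in> carrier_mat n n \<and> (\<forall>i<n. \<forall>j<n. A $$ (i, j) \<noteq> 0 \<longrightarrow>
     [int (i div m) = int (j div m) + z * int r] (mod int l))"

lemma div_m_less: "i < n \<Longrightarrow> i div m < l"
  by (simp add: less_mult_imp_div_less)

lemma graded_one: "graded 0 (1\<^sub>m n)"
  by (auto simp: graded_def one_mat_def)

text \<open>A nonzero entry of the product comes from some intermediate index \<open>q\<close> with
  both factors nonzero, and the two shifts add.\<close>

lemma graded_mult:
  assumes "graded z A" "graded w B"
  shows "graded (z + w) (A * B)"
proof -
  have c: "A \<in> carrier_mat n n" "B \<in> carrier_mat n n" using assms by (auto simp: graded_def)
  have "[int (i div m) = int (j div m) + (z + w) * int r] (mod int l)"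
    if "i < n" "j < n" "(A * B) $$ (i, j) \<noteq> 0" for i j
  proof -
    have "(\<Sum>q\<in>{0..<n}. A $$ (i, q) * B $$ (q, j)) \<noteq> 0"
      using that c by (simp add: scalar_prod_def)
    then obtain q where "q < n" "A $$ (i, q) \<noteq> 0" "B $$ (q, j) \<noteq> 0"
      by (metis (no_types, lifting) atLeastLessThan_iff mult_eq_0_iff sum.neutral)
    then have "[int (i div m) = int (q div m) + z * int r] (mod int l)"
      "[int (q div m) = int (j div m) + w * int r] (mod int l)"
      using assms that by (auto simp: graded_def)
    then show ?thesis
      using cong_trans cong_add[OF _ cong_refl, of "int (q div m)" _ "int l" "z * int r"]
      by (fastforce simp: algebra_simps)
  qed
  then show ?thesis using c by (auto simp: graded_def)
qed

text \<open>
  With \<open>D b\<close> the projection onto the block \<open>b\<close>, gradedness says \<open>D (b + z r) A = A D b\<close>, which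
  is inverted at once.
\<close>

lemma graded_inverse:
  assumes "graded z A" "B \<in> carrier_mat n n" "B * A = 1\<^sub>m n" "A * B = 1\<^sub>m n"
  shows "graded (- z) B"
proof -
  \<comment> \<open>The block is named by an integer up to congruence, so
    \<open>b + z * int r\<close> needs no reduction.\<close>
  define D where "D b = mat n n (\<lambda>(i, j). if i = j \<and> [int (i div m) = b] (mod int l) then 1 else 0 :: complex)"
    for b
  have Dc: "D b \<in> carrier_mat n n" for b by (simp add: D_def)
  have Ac: "A \<in> carrier_mat n n" using assms(1) by (simp add: graded_def)
  have left: "(D b * X) $$ (i, j) = (if [int (i div m) = b] (mod int l) then X $$ (i, j) else 0)"
    if "X \<in> carrier_mat n n" "i < n" "j < n" for b X i j
  proof -
    have "(D b * X) $$ (i, j) = (\<Sum>q\<in>{0..<n}. D b $$ (i, q) * X $$ (q, j))"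
      using that Dc[of b] by (simp add: scalar_prod_def)
    also have "\<dots> = (\<Sum>q\<in>{0..<n}. if q = i then (if [int (i div m) = b] (mod int l) then X $$ (i, j) else 0) else 0)"
      using that by (intro sum.cong) (auto simp: D_def)
    finally show ?thesis using that by simp
  qed
  have right: "(X * D b) $$ (i, j) = (if [int (j div m) = b] (mod int l) then X $$ (i, j) else 0)"
    if "X \<in> carrier_mat n n" "i < n" "j < n" for b X i j
  proof -
    have "(X * D b) $$ (i, j) = (\<Sum>q\<in>{0..<n}. X $$ (i, q) * D b $$ (q, j))"
      using that Dc[of b] by (simp add: scalar_prod_def)
    also have "\<dots> = (\<Sum>q\<in>{0..<n}. if q = j then (if [int (j div m) = b] (mod int l) then X $$ (i, j) else 0) else 0)"
      using that by (intro sum.cong) (auto simp: D_def)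
    finally show ?thesis using that by simp
  qed
  have "D (b + z * int r) * A = A * D b" for b
  proof (rule eq_matI)
    fix i j assume "i < dim_row (A * D b)" "j < dim_col (A * D b)"
    then have ij: "i < n" "j < n" using Ac Dc[of b] by auto
    have "[int (i div m) = b + z * int r] (mod int l) \<longleftrightarrow> [int (j div m) = b] (mod int l)"
      if "A $$ (i, j) \<noteq> 0"
    proof -
      have *: "[int (i div m) = int (j div m) + z * int r] (mod int l)"
        using assms(1) ij that by (auto simp: graded_def)
      have "[int (i div m) = b + z * int r] (mod int l) \<longleftrightarrow>
          [int (j div m) + z * int r = b + z * int r] (mod int l)"
        using * cong_trans cong_sym by blast
      then show ?thesis by (simp only: cong_add_rcancel)
    qed
    then show "(D (b + z * int r) * A) $$ (i, j) = (A * D b) $$ (i, j)"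
      using left[OF Ac ij] right[OF Ac ij] by auto
  qed (use Ac Dc[THEN carrier_matD(1)] Dc[THEN carrier_matD(2)] in auto)
  then have conj: "B * (D (b + z * int r) * A) * B = B * (A * D b) * B" for b by simp
  have "B * D (b + z * int r) * (A * B) = (B * A) * D b * B" for b
    using conj[of b] mult_carrier_mat[OF Dc Ac] mult_carrier_mat[OF Ac Dc] Ac Dc assms(2)
    by (simp add: assoc_mult_mat[of _ n n _ n _ n])
  then have comm: "B * D (b + z * int r) = D b * B" for b
    using right_mult_one_mat[OF mult_carrier_mat[OF assms(2) Dc]] left_mult_one_mat[OF Dc] assms(3,4)
    by simp
  have "[int (i div m) = int (j div m) + (- z) * int r] (mod int l)"
    if ij: "i < n" "j < n" "B $$ (i, j) \<noteq> 0" for i j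
  proof -
    \<comment> \<open>Compare the entries at \<open>(i, j)\<close> in \<open>comm\<close> for the
      block \<open>b\<close> of row \<open>i\<close>: the right side is \<open>B $$ (i, j)\<close>,
      which is nonzero, so \<open>D (b + z * int r)\<close> must keep column
      \<open>j\<close>.\<close>
    have "[int (j div m) = int (i div m) + z * int r] (mod int l)"
      using arg_cong[OF comm[of "int (i div m)"], of "\<lambda>X. X $$ (i, j)"] ij
        left[OF assms(2) ij(1,2)] right[OF assms(2) ij(1,2)] by (auto split: if_splits)
    from cong_diff[OF this cong_refl, of "z * int r"] show ?thesis
      by (simp add: cong_sym)
  qed
  then show ?thesis using assms(2) by (auto simp: graded_def)
qed

lemma graded_inv:
  assumes "A \<in> carrier (GL n)" "graded z A"
  shows "graded (- z) (inv\<^bsub>GL n\<^esub> A)"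
proof -
  interpret group "GL n" by (rule group_GL)
  show ?thesis
    using graded_inverse[OF assms(2)] assms(1) inv_closed[OF assms(1)] l_inv[OF assms(1)] r_inv[OF assms(1)]
    by (simp add: GL_simps carrier_GL_iff)
qed

section \<open>The cyclic shift matrix and its powers\<close>

lemma shift_mat_graded: "graded 1 S"
proof -
  \<comment> \<open>Shifting by a multiple of \<open>m\<close> moves only the block number, and
    reduction modulo \<open>l * m\<close> reduces that number modulo \<open>l\<close>.\<close>
  have "(j + r * m) mod n div m = (j div m + r) mod l" for j
  proof -
    have "(j + r * m) mod (m * l) = m * ((j + r * m) div m mod l) + (j + r * m) mod m"
      by (rule mod_mult2_eq)
    then show ?thesis using m_pos by (simp add: ac_simps)
  qed
  then show ?thesis by (auto simp: graded_def shift_mat_def cong_def zmod_int mod_simps split: if_splits)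
qed

text \<open>The columns are distinct unit vectors, so the transpose is a left inverse; for square
  matrices this is also a right inverse.\<close>

lemma shift_mat_GL: "S \<in> carrier (GL n)"
proof -
  have Sc: "S \<in> carrier_mat n n" by (simp add: shift_mat_def)
  let ?p = "\<lambda>j. (j + r * m) mod n"
  have inj: "?p i = ?p j \<longleftrightarrow> i = j" if "i < n" "j < n" for i j
  proof
    assume "?p i = ?p j"
    then have "[i = j] (mod n)" unfolding cong_def[symmetric] by (simp only: cong_add_rcancel_nat)
    then show "i = j" using that by (simp add: cong_def)
  qed simp
  have "transpose_mat S * S = 1\<^sub>m n"
  proof (rule eq_matI)
    fix i j assume "i < dim_row (1\<^sub>m n :: complex mat)" "j < dim_col (1\<^sub>m n :: complex mat)"
    then have ij: "i < n" "j < n" by auto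
    have "(transpose_mat S * S) $$ (i, j) = (\<Sum>q\<in>{0..<n}. S $$ (q, i) * S $$ (q, j))"
      using ij Sc by (simp add: scalar_prod_def)
    also have "\<dots> = (\<Sum>q\<in>{0..<n}. if q = ?p i then of_bool (?p i = ?p j) else 0)"
      using ij by (intro sum.cong) (auto simp: shift_mat_def)
    also have "\<dots> = 1\<^sub>m n $$ (i, j)" using ij inj[OF ij] mod_less_divisor[of n] l_pos m_pos by auto
    finally show "(transpose_mat S * S) $$ (i, j) = 1\<^sub>m n $$ (i, j)" .
  qed (use Sc in auto)
  moreover from this have "S * transpose_mat S = 1\<^sub>m n"
    using mat_mult_left_right_inverse[OF _ Sc] Sc by simp
  ultimately show ?thesis
    using Sc unfolding carrier_GL_iff by (intro conjI bexI[of _ "transpose_mat S"]) auto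
qed

lemma shift_pow_graded: "graded z (S [^]\<^bsub>GL n\<^esub> (z::int))"
proof -
  interpret group "GL n" by (rule group_GL)
  have npow: "graded (int c) (S [^]\<^bsub>GL n\<^esub> c)" for c :: nat
  proof (induction c)
    case 0
    then show ?case by (simp add: GL_simps graded_one)
  next
    case (Suc c)
    then show ?case using graded_mult[OF Suc shift_mat_graded] by (simp add: GL_simps add.commute)
  qed
  show ?thesis
  proof (cases z rule: int_cases2)
    case (nonneg c)
    then show ?thesis using npow by (simp add: int_pow_int)
  next
    case (nonpos c)
    then show ?thesis
      using graded_inv[OF nat_pow_closed[OF shift_mat_GL] npow] int_pow_neg_int[OF shift_mat_GL] by simp
  qed
qed

section \<open>The block diagonal group and the values of free product words\<close>

lemma carrier_GL_blocks: "carrier (GL_blocks l m) = {A \<in> carrier (GL n). graded 0 A}"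
proof -
  \<comment> \<open>Block numbers lie below \<open>l\<close>, so congruence is equality and degree 0
    means block diagonal.\<close>
  have "[int (i div m) = int (j div m)] (mod int l) \<longleftrightarrow> i div m = j div m" if "i < n" "j < n" for i j
    using that[THEN div_m_less] by (simp add: cong_def)
  then show ?thesis by (auto simp: GL_blocks_def graded_def carrier_GL_iff)
qed

lemma group_GL_blocks: "group (GL_blocks l m)"
proof -
  interpret group "GL n" by (rule group_GL)
  have "subgroup (carrier (GL_blocks l m)) (GL n)"
  proof (rule subgroupI)
    show "carrier (GL_blocks l m) \<noteq> {}"
      using graded_one one_closed by (auto simp: carrier_GL_blocks GL_simps)
    fix A B assume A: "A \<in> carrier (GL_blocks l m)" and B: "B \<in> carrier (GL_blocks l m)"
    show "inv\<^bsub>GL n\<^esub> A \<in> carrier (GL_blocks l m)"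
      using A graded_inv[of A 0] by (simp add: carrier_GL_blocks)
    show "A \<otimes>\<^bsub>GL n\<^esub> B \<in> carrier (GL_blocks l m)"
      using A B graded_mult[of 0 A 0 B] m_closed[of A B] by (simp add: carrier_GL_blocks GL_simps)
  qed (simp add: carrier_GL_blocks)
  from subgroup.subgroup_is_group[OF this is_group] show ?thesis by (simp add: GL_blocks_def)
qed

lemma GLZ_matrix_class:
  assumes "w \<in> fp_words (GL_blocks l m) integer_group"
  shows "GLZ_matrix l k m (fp_rel (GL_blocks l m) integer_group `` {w}) =
    fp_eval (GL n) (\<lambda>A. A) (\<lambda>z. S [^]\<^bsub>GL n\<^esub> z) w"
proof -
  interpret group "GL n" by (rule group_GL)
  have "(\<lambda>A. A) \<in> hom (GL_blocks l m) (GL n)"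
    by (auto simp: hom_def carrier_GL_blocks) (simp add: GL_blocks_def)
  moreover have "(\<lambda>z::int. S [^]\<^bsub>GL n\<^esub> z) \<in> hom integer_group (GL n)"
    using int_pow_mult[OF shift_mat_GL] int_pow_closed[OF shift_mat_GL]
    by (auto simp: hom_def)
  ultimately show ?thesis
    unfolding GLZ_matrix_def using assms
    by (intro fp_lift_class group_GL_blocks group_GL) auto
qed

lemma carrier_GLZ:
  "carrier (GLZ l m) = (\<lambda>w. fp_rel (GL_blocks l m) integer_group `` {w}) `
     fp_words (GL_blocks l m) integer_group"
  by (auto simp: GLZ_def free_product_def quotient_def)

text \<open>Letters from the block diagonal group have degree 0, a letter from the integers has
  itself as degree, and degrees add along a word.\<close>

lemma GLZ_matrix_graded:
  assumes "x \<in> carrier (GLZ l m)"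
  obtains z where "graded z (GLZ_matrix l k m x)"
proof -
  obtain w where w: "w \<in> fp_words (GL_blocks l m) integer_group"
    and x: "x = fp_rel (GL_blocks l m) integer_group `` {w}"
    using assms by (auto simp: carrier_GLZ)
  have "\<exists>z. graded z (fp_eval (GL n) (\<lambda>A. A) (\<lambda>z. S [^]\<^bsub>GL n\<^esub> z) w)"
    using w
  proof (induction w)
    case Nil
    then show ?case using graded_one by (auto simp: fp_eval_def GL_simps)
  next
    case (Cons s w)
    then obtain z where z: "graded z (fp_eval (GL n) (\<lambda>A. A) (\<lambda>z. S [^]\<^bsub>GL n\<^esub> z) w)"
      by (auto simp: fp_words_def)
    have "\<exists>y. graded y (case_sum (\<lambda>A. A) (\<lambda>z::int. S [^]\<^bsub>GL n\<^esub> z) s)"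
      using Cons.prems shift_pow_graded
      by (cases s) (auto simp: fp_words_def carrier_GL_blocks)
    then show ?case using graded_mult z by (fastforce simp: fp_eval_def GL_simps)
  qed
  then show thesis using that GLZ_matrix_class[OF w] x by auto
qed

text \<open>Two-letter words already supply all the group elements used for spanning.\<close>

lemma GLZ_matrix_shift_block:
  assumes "A \<in> carrier (GL_blocks l m)"
  obtains x where "x \<in> carrier (GLZ l m)" "GLZ_matrix l k m x = S [^]\<^bsub>GL n\<^esub> (z::int) * A"
proof -
  let ?w = "[Inr z, Inl A] :: (complex mat + int) list"
  have w: "?w \<in> fp_words (GL_blocks l m) integer_group"
    using assms by (simp add: fp_words_def InlI InrI)
  have "A \<in> carrier_mat n n" using assms by (auto simp: carrier_GL_blocks graded_def)
  then have "fp_eval (GL n) (\<lambda>A. A) (\<lambda>z. S [^]\<^bsub>GL n\<^esub> z) ?w = S [^]\<^bsub>GL n\<^esub> z * A"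
    by (simp add: fp_eval_def GL_simps)
  then show thesis using that w GLZ_matrix_class[OF w] by (auto simp: carrier_GLZ)
qed

abbreviation MI where "MI \<equiv> multi_indices n d"
abbreviation H where "H \<equiv> cyc_subgroup l k"

section \<open>The span of the group action\<close>

definition spanned :: "((nat \<Rightarrow> nat) \<Rightarrow> (nat \<Rightarrow> nat) \<Rightarrow> complex) \<Rightarrow> bool" where
  "spanned Y \<longleftrightarrow> tensor_op n d Y \<in> GLZ_action l k d m ` carrier (group_algebra (GLZ l m))"

abbreviation GLZ_power where
  "GLZ_power x \<equiv> \<lambda>I J. \<Prod>p<d. GLZ_matrix l k m x $$ (I p, J p)"

lemma GLZ_action_eq:
  "GLZ_action l k d m a = tensor_op n d (\<lambda>I J. \<Sum>x | a x \<noteq> 0. a x * GLZ_power x I J)"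
proof
  fix t
  have "(\<Sum>x | a x \<noteq> 0. a x * tensor_op n d (GLZ_power x) t I) =
      tensor_op n d (\<lambda>I J. \<Sum>x | a x \<noteq> 0. a x * GLZ_power x I J) t I" if "t \<in> tensors n d" for I
  proof (cases "I \<in> MI")
    case True
    have "(\<Sum>x | a x \<noteq> 0. a x * (\<Sum>J\<in>MI. GLZ_power x I J * t J)) =
        (\<Sum>J\<in>MI. (\<Sum>x | a x \<noteq> 0. a x * GLZ_power x I J) * t J)"
      unfolding sum_distrib_left sum_distrib_right mult.assoc by (rule sum.swap)
    then show ?thesis using that True by (simp add: tensor_op_def)
  next
    case False
    then show ?thesis using that by (simp add: tensor_op_def)
  qed
  then show "GLZ_action l k d m a t =
      tensor_op n d (\<lambda>I J. \<Sum>x | a x \<noteq> 0. a x * GLZ_power x I J) t"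
    by (cases "t \<in> tensors n d")
      (simp_all add: GLZ_action_def linear_extension_def tensor_power_eq_tensor_op,
        simp add: tensor_op_def)
qed

lemma carrier_group_algebra_GLZ:
  "carrier (group_algebra (GLZ l m)) = {a. finite {x. a x \<noteq> 0} \<and> {x. a x \<noteq> 0} \<subseteq> carrier (GLZ l m)}"
  by (simp add: group_algebra_def basis_algebra_def)

lemma spannedI:
  assumes "finite F" "F \<subseteq> carrier (GLZ l m)"
    and "\<And>I J. I \<in> MI \<Longrightarrow> J \<in> MI \<Longrightarrow> Y I J = (\<Sum>x\<in>F. c x * GLZ_power x I J)"
  shows "spanned Y"
proof -
  \<comment> \<open>The coefficients \<open>c\<close> may vanish on parts of \<open>F\<close>, so
    the support of \<open>a\<close> is only contained in \<open>F\<close>.\<close>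
  define a where "a x = (if x \<in> F then c x else 0)" for x
  have supp: "{x. a x \<noteq> 0} \<subseteq> F" by (auto simp: a_def)
  then have "a \<in> carrier (group_algebra (GLZ l m))"
    using assms(1,2) finite_subset by (auto simp: carrier_group_algebra_GLZ)
  moreover have "(\<Sum>x | a x \<noteq> 0. a x * GLZ_power x I J) = (\<Sum>x\<in>F. c x * GLZ_power x I J)" for I J
    by (rule sum.mono_neutral_cong_left[OF assms(1) supp]) (auto simp: a_def)
  then have "tensor_op n d Y = GLZ_action l k d m a"
    unfolding GLZ_action_eq using assms(3) by (intro tensor_op_cong) simp
  ultimately show ?thesis by (auto simp: spanned_def)
qed

lemma spannedE:
  assumes "spanned Y"
  obtains F c where "finite F" "F \<subseteq> carrier (GLZ l m)"
    "\<forall>I\<in>MI. \<forall>J\<in>MI. Y I J = (\<Sum>x\<in>F. c x * GLZ_power x I J)"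
proof -
  obtain a where "a \<in> carrier (group_algebra (GLZ l m))" "tensor_op n d Y = GLZ_action l k d m a"
    using assms by (auto simp: spanned_def)
  then show thesis
    using that[of "{x. a x \<noteq> 0}" a] by (simp add: carrier_group_algebra_GLZ GLZ_action_eq tensor_op_eq_iff)
qed

lemma spanned_add:
  assumes "spanned Y" "spanned Z"
  shows "spanned (\<lambda>I J. Y I J + Z I J)"
proof -
  obtain F b where F: "finite F" "F \<subseteq> carrier (GLZ l m)"
    and Fsum: "\<forall>I\<in>MI. \<forall>J\<in>MI. Y I J = (\<Sum>x\<in>F. b x * GLZ_power x I J)"
    using spannedE[OF assms(1)] .
  obtain G c where G: "finite G" "G \<subseteq> carrier (GLZ l m)"
    and Gsum: "\<forall>I\<in>MI. \<forall>J\<in>MI. Z I J = (\<Sum>x\<in>G. c x * GLZ_power x I J)"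
    using spannedE[OF assms(2)] .
  show ?thesis
  proof (rule spannedI)
    fix I J assume IJ: "I \<in> MI" "J \<in> MI"
    have "Y I J = (\<Sum>x\<in>F \<union> G. (if x \<in> F then b x else 0) * GLZ_power x I J)"
      unfolding Fsum[rule_format, OF IJ] using F(1) G(1) by (intro sum.mono_neutral_cong_left) auto
    moreover have "Z I J = (\<Sum>x\<in>F \<union> G. (if x \<in> G then c x else 0) * GLZ_power x I J)"
      unfolding Gsum[rule_format, OF IJ] using F(1) G(1) by (intro sum.mono_neutral_cong_left) auto
    ultimately show "Y I J + Z I J =
        (\<Sum>x\<in>F \<union> G. ((if x \<in> F then b x else 0) + (if x \<in> G then c x else 0)) * GLZ_power x I J)"
      by (simp only: sum.distrib distrib_right)
  qed (use F G in auto)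
qed

lemma spanned_smult:
  assumes "spanned Y"
  shows "spanned (\<lambda>I J. c * Y I J)"
proof -
  obtain F b where F: "finite F" "F \<subseteq> carrier (GLZ l m)"
    and Fsum: "\<forall>I\<in>MI. \<forall>J\<in>MI. Y I J = (\<Sum>x\<in>F. b x * GLZ_power x I J)"
    using spannedE[OF assms(1)] .
  show ?thesis
    by (rule spannedI[where c = "\<lambda>x. c * b x", OF F(1,2)])
      (simp add: Fsum sum_distrib_left mult.assoc)
qed

lemma spanned_sum:
  assumes "finite F" "\<And>i. i \<in> F \<Longrightarrow> spanned (Y i)"
  shows "spanned (\<lambda>I J. \<Sum>i\<in>F. c i * Y i I J)"
  using assms
proof (induction F rule: finite_induct)
  case empty
  show ?case by (rule spannedI[of "{}"]) auto
next
  case (insert x F)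
  then show ?case using spanned_add[OF spanned_smult] by simp
qed

lemma spanned_cong:
  assumes "spanned Y" "\<And>I J. I \<in> MI \<Longrightarrow> J \<in> MI \<Longrightarrow> Y I J = Z I J"
  shows "spanned Z"
  using assms tensor_op_cong[of n d Y Z] by (simp add: spanned_def)

text \<open>
  A graded matrix \<open>h\<close> may be singular, but \<open>h - e S\<^sup>z\<close> lies in the group for all but finitely
  many \<open>e\<close>; the tensor power of \<open>h\<close> is recovered from these by interpolation at \<open>e = 0\<close>.
\<close>

lemma spanned_graded:
  assumes "graded z h"
  shows "spanned (\<lambda>I J. \<Prod>p<d. h $$ (I p, J p))"
proof -
  interpret group "GL n" by (rule group_GL)
  define P where "P = S [^]\<^bsub>GL n\<^esub> z"
  have PG: "P \<in> carrier (GL n)" unfolding P_def using shift_mat_GL by (rule int_pow_closed)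
  define Q where "Q = inv\<^bsub>GL n\<^esub> P"
  have Qgr: "graded (- z) Q" unfolding Q_def using graded_inv[OF PG] shift_pow_graded by (simp add: P_def)
  have PQ: "P * Q = 1\<^sub>m n" using r_inv[OF PG] by (simp add: GL_simps Q_def)
  have Pc: "P \<in> carrier_mat n n" and Qc: "Q \<in> carrier_mat n n" and hc: "h \<in> carrier_mat n n"
    using PG Qgr assms by (auto simp: carrier_GL_iff graded_def)
  \<comment> \<open>Splitting off the shift, \<open>h = P * B\<close>, leaves a factor of degree 0,
    which can be perturbed inside the block diagonal matrices.\<close>
  define B where "B = Q * h"
  have Bgr: "graded 0 B" using graded_mult[OF Qgr assms] by (simp add: B_def)
  then have Bc: "B \<in> carrier_mat n n" by (simp add: graded_def)
  have PB: "P * B = h" using PQ Pc Qc hc by (simp add: B_def flip: assoc_mult_mat[of _ n n _ n _ n])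
  \<comment> \<open>Only the finitely many eigenvalues \<open>e\<close> of \<open>B\<close> make
    \<open>B - e\<close> singular, so \<open>d + 1\<close> admissible nodes exist.\<close>
  have "infinite (UNIV - spectrum B)"
    using card_finite_spectrum(1)[OF Bc] infinite_UNIV_char_0[where 'a = complex]
    by (simp add: Diff_infinite_finite)
  then obtain T where T: "T \<subseteq> UNIV - spectrum B" "finite T" "card T = Suc d"
    using infinite_arbitrarily_large by metis
  obtain c where c: "\<And>p. degree p \<le> d \<Longrightarrow> poly p 0 = (\<Sum>e\<in>T. c e * poly p e)"
    using lagrange_functional[OF T(3), of 0] by blast
  \<comment> \<open>\<open>char_matrix B e\<close> is \<open>B - e\<close>, hence
    \<open>P * char_matrix B e\<close> is \<open>h - e P\<close>.\<close>
  have "\<exists>x\<in>carrier (GLZ l m). GLZ_matrix l k m x = P * char_matrix B e" if "e \<in> T" for e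
  proof -
    have "det (char_matrix B e) \<noteq> 0"
      using that T(1) eigenvalue_det[OF Bc] by (auto simp: spectrum_def)
    then have "char_matrix B e \<in> carrier (GL n)"
      using det_non_zero_imp_unit[OF char_matrix_closed[OF Bc]] by (simp add: GL_def units_of_def)
    moreover have "graded 0 (char_matrix B e)"
      using Bgr Bc by (auto simp: graded_def char_matrix_def)
    ultimately show ?thesis
      using GLZ_matrix_shift_block[of "char_matrix B e" z] unfolding carrier_GL_blocks P_def by blast
  qed
  then obtain x where x: "\<And>e. e \<in> T \<Longrightarrow> x e \<in> carrier (GLZ l m)"
    and Mx: "\<And>e. e \<in> T \<Longrightarrow> GLZ_matrix l k m (x e) = P * char_matrix B e"
    by metis
  have entry: "GLZ_matrix l k m (x e) $$ (i, j) = h $$ (i, j) - e * P $$ (i, j)"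
    if "e \<in> T" "i < n" "j < n" for e i j
  proof -
    have "P * char_matrix B e = h + (- e) \<cdot>\<^sub>m P"
      using Bc Pc PB mult_smult_distrib[OF Pc one_carrier_mat, of "- e"]
      by (simp add: char_matrix_def mult_add_distrib_mat[of _ n n])
    then show ?thesis using that Mx Pc hc by simp
  qed
  have "spanned (GLZ_power (x e))" if "e \<in> T" for e
    by (rule spannedI[of "{x e}" _ "\<lambda>_. 1"]) (use x that in auto)
  then have "spanned (\<lambda>I J. \<Sum>e\<in>T. c e * GLZ_power (x e) I J)"
    by (rule spanned_sum[OF T(2)])
  then show ?thesis
  proof (rule spanned_cong)
    fix I J assume "I \<in> MI" "J \<in> MI"
    then have IJ: "I p < n" "J p < n" if "p < d" for p using that by (auto simp: multi_indices_def)
    \<comment> \<open>The entry of the tensor power of \<open>h - e P\<close> as a polynomial in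
      \<open>e\<close>: each of the \<open>d\<close> factors is linear, and the value at 0 is the
      entry for \<open>h\<close>.\<close>
    define q where "q = (\<Prod>p<d. [:h $$ (I p, J p), - P $$ (I p, J p):])"
    have "degree q \<le> (\<Sum>p<d. degree [:h $$ (I p, J p), - P $$ (I p, J p):])"
      unfolding q_def by (rule order.trans[OF degree_prod_sum_le]) auto
    also have "\<dots> \<le> (\<Sum>p<d. 1)" by (intro sum_mono) (simp add: degree_pCons_le)
    finally have "degree q \<le> d" by simp
    have "GLZ_power (x e) I J = poly q e" if "e \<in> T" for e
      unfolding q_def poly_prod by (intro prod.cong) (auto simp: entry that IJ)
    then have "(\<Sum>e\<in>T. c e * GLZ_power (x e) I J) = (\<Sum>e\<in>T. c e * poly q e)" by simp
    also have "\<dots> = poly q 0" using c[OF \<open>degree q \<le> d\<close>] by simp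
    also have "\<dots> = (\<Prod>p<d. h $$ (I p, J p))" by (simp add: q_def poly_prod)
    finally show "(\<Sum>e\<in>T. c e * GLZ_power (x e) I J) = (\<Prod>p<d. h $$ (I p, J p))" .
  qed
qed

section \<open>Block types and symmetrized matrix units\<close>

definition same_orbit :: "(nat \<Rightarrow> nat) \<Rightarrow> (nat \<Rightarrow> nat) \<Rightarrow> bool" where
  "same_orbit f g \<longleftrightarrow> (\<exists>z. \<forall>i<d. [int (f i) = int (g i) + z * int r] (mod int l))"

text \<open>The object \<open>f\<close> whose summand \<open>G(f)\<close> contains the basis tensor
  of \<open>I\<close>.\<close>

definition block_type :: "(nat \<Rightarrow> nat) \<Rightarrow> nat \<Rightarrow> nat" where
  "block_type I = (\<lambda>i\<in>{..<d}. I i div m)"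

text \<open>The sum runs over permutations rather than over the orbit of \<open>(I, J)\<close>, so
  each matrix unit is counted once for every element of the stabilizer of the pair.\<close>

definition symmetrized_unit ::
    "(nat \<Rightarrow> nat) \<Rightarrow> (nat \<Rightarrow> nat) \<Rightarrow> (nat \<Rightarrow> nat) \<Rightarrow> (nat \<Rightarrow> nat) \<Rightarrow> complex" where
  "symmetrized_unit I J = (\<lambda>K L. \<Sum>\<sigma> | \<sigma> permutes {..<d}. of_bool (K = I \<circ> \<sigma> \<and> L = J \<circ> \<sigma>))"

lemma comp_multi_index:
  assumes "\<sigma> permutes {..<d}" "I \<in> MI"
  shows "I \<circ> \<sigma> \<in> MI"
  using assms permute_multi_index by blast

lemma multi_index_eqI:
  assumes "I \<in> MI" "J \<in> MI" "\<And>i. i < d \<Longrightarrow> I i = J i"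
  shows "I = J"
  using assms unfolding multi_indices_def by (metis PiE_ext lessThan_iff)

text \<open>The matrix units at \<open>(I p, J p)\<close> share one degree \<open>z\<close>, so
  every partial sum of them is graded and has a spanned tensor power. \<open>polarization\<close>
  combines these powers into the symmetrized unit.\<close>

lemma spanned_symmetrized_unit:
  assumes "I \<in> MI" "J \<in> MI" "same_orbit (block_type I) (block_type J)"
  shows "spanned (symmetrized_unit I J)"
proof -
  obtain z where z: "\<And>i. i < d \<Longrightarrow> [int (I i div m) = int (J i div m) + z * int r] (mod int l)"
    using assms(3) by (auto simp: same_orbit_def block_type_def)
  \<comment> \<open>The sum of the matrix units at \<open>(I p, J p)\<close> for \<open>p\<close> in
    \<open>A\<close>; coinciding positions add up.\<close>
  let ?h = "\<lambda>A. mat n n (\<lambda>(i, j). \<Sum>p\<in>A. of_bool (i = I p \<and> j = J p) :: complex)"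
  have "graded z (?h A)" if "A \<in> Pow {..<d}" for A
  proof -
    have "[int (i div m) = int (j div m) + z * int r] (mod int l)"
      if "i < n" "j < n" "?h A $$ (i, j) \<noteq> 0" for i j
    proof -
      have "(\<Sum>p\<in>A. of_bool (i = I p \<and> j = J p) :: complex) \<noteq> 0" using that by simp
      then obtain p where "p \<in> A" "i = I p" "j = J p"
        by (metis (mono_tags, lifting) of_bool_eq_0_iff sum.neutral)
      then show ?thesis using z \<open>A \<in> Pow {..<d}\<close> by blast
    qed
    then show ?thesis by (simp add: graded_def)
  qed
  then have "spanned (\<lambda>K L. \<Sum>A\<in>Pow {..<d}. (-1) ^ (d - card A) * (\<Prod>p<d. ?h A $$ (K p, L p)))"
    using spanned_sum[where Y = "\<lambda>A K L. \<Prod>p<d. ?h A $$ (K p, L p)" and F = "Pow {..<d}"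
        and c = "\<lambda>A. (-1) ^ (d - card A)"] by (blast intro: spanned_graded finite_Pow_iff[THEN iffD2])
  then show ?thesis
  proof (rule spanned_cong)
    fix K L assume KL: "K \<in> MI" "L \<in> MI"
    have "(\<Prod>p<d. ?h A $$ (K p, L p)) = (\<Prod>p<d. \<Sum>q\<in>A. of_bool (K p = I q \<and> L p = J q))" for A
      using KL by (intro prod.cong refl) (auto simp: multi_indices_def PiE_iff)
    then have "(\<Sum>A\<in>Pow {..<d}. (-1) ^ (d - card A) * (\<Prod>p<d. ?h A $$ (K p, L p))) =
        (\<Sum>\<sigma> | \<sigma> permutes {..<d}. \<Prod>p<d. of_bool (K p = I (\<sigma> p) \<and> L p = J (\<sigma> p)))"
      using polarization[of d "\<lambda>q p. of_bool (K p = I q \<and> L p = J q)"] by (simp only:)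
    also have "\<dots> = symmetrized_unit I J K L"
      unfolding symmetrized_unit_def
    proof (rule sum.cong[OF refl])
      fix \<sigma> assume "\<sigma> \<in> {\<sigma>. \<sigma> permutes {..<d}}"
      then have "I \<circ> \<sigma> \<in> MI" "J \<circ> \<sigma> \<in> MI" using assms(1,2) comp_multi_index by auto
      then have iff: "K = I \<circ> \<sigma> \<and> L = J \<circ> \<sigma> \<longleftrightarrow> (\<forall>p<d. K p = I (\<sigma> p) \<and> L p = J (\<sigma> p))"
        using multi_index_eqI[of K "I \<circ> \<sigma>"] multi_index_eqI[of L "J \<circ> \<sigma>"] KL by auto
      show "(\<Prod>p<d. of_bool (K p = I (\<sigma> p) \<and> L p = J (\<sigma> p))) =
          (of_bool (K = I \<circ> \<sigma> \<and> L = J \<circ> \<sigma>) :: complex)"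
        unfolding iff by (cases "\<forall>p<d. K p = I (\<sigma> p) \<and> L p = J (\<sigma> p)") (auto intro!: prod.neutral)
    qed
    finally show "(\<Sum>A\<in>Pow {..<d}. (-1) ^ (d - card A) * (\<Prod>p<d. ?h A $$ (K p, L p))) =
      symmetrized_unit I J K L" .
  qed
qed

section \<open>Orbits of morphisms\<close>

lemma same_orbit_refl [simp]: "same_orbit f f"
  unfolding same_orbit_def by (intro exI[of _ 0]) simp

lemma same_orbit_trans:
  assumes "same_orbit f g" "same_orbit g h"
  shows "same_orbit f h"
proof -
  obtain z w where z: "\<And>i. i < d \<Longrightarrow> [int (f i) = int (g i) + z * int r] (mod int l)"
    and w: "\<And>i. i < d \<Longrightarrow> [int (g i) = int (h i) + w * int r] (mod int l)"
    using assms by (auto simp: same_orbit_def)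
  have "[int (f i) = int (h i) + (w + z) * int r] (mod int l)" if "i < d" for i
    using cong_trans[OF z[OF that] cong_add[OF w[OF that] cong_refl]] by (simp add: algebra_simps)
  then show ?thesis by (auto simp: same_orbit_def)
qed

lemma same_orbit_sym:
  assumes "same_orbit f g"
  shows "same_orbit g f"
proof -
  obtain z where z: "\<And>i. i < d \<Longrightarrow> [int (f i) = int (g i) + z * int r] (mod int l)"
    using assms by (auto simp: same_orbit_def)
  have "[int (g i) = int (f i) + (- z) * int r] (mod int l)" if "i < d" for i
    using cong_diff[OF cong_sym[OF z[OF that]] cong_refl, of "z * int r"] by simp
  then show ?thesis unfolding same_orbit_def by blast
qed

lemma same_orbit_iff:
  assumes "f \<in> gpd_obj l d" "g \<in> gpd_obj l d"
  shows "same_orbit f g \<longleftrightarrow> (\<exists>h\<in>H. f = act_obj d h g)"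
  unfolding same_orbit_def in_orbit_iff_cong[OF l_pos assms] ..

lemma act_obj_closed:
  assumes "h \<in> H" "f \<in> gpd_obj l d"
  shows "act_obj d h f \<in> gpd_obj l d"
proof -
  obtain z where h: "h = rotation l z" using assms(1) by (auto simp: cyc_subgroup_eq[OF l_pos])
  have "h i < l" if "i < l" for i
    using that l_pos pos_mod_bound[of "int l" "int i + z"] by (simp add: h rotation_def nat_less_iff)
  then show ?thesis using assms(2) by (auto simp: act_obj_def gpd_obj_def compose_def)
qed

text \<open>Since \<sigma> is bijective, the source determines the target. An orbit is thus recorded
  by the bijection and the orbit of the source.\<close>

lemma mem_mor_orbit_iff:
  assumes "(f, \<sigma>, g) \<in> gpd_mor l d"
  shows "(f', \<sigma>', g') \<in> mor_orbit l k d (f, \<sigma>, g) \<longleftrightarrow>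
    \<sigma>' = \<sigma> \<and> (f', \<sigma>, g') \<in> gpd_mor l d \<and> same_orbit f' f"
proof -
  have f: "f \<in> gpd_obj l d" and g: "g \<in> gpd_obj l d" and \<sigma>: "\<sigma> permutes {..<d}" and gf: "g \<circ> \<sigma> = f"
    using assms by (auto simp: gpd_mor_def)
  have \<sigma>d: "\<sigma> i < d \<longleftrightarrow> i < d" for i using permutes_in_image[OF \<sigma>, of i] by simp
  have comp: "act_obj d h g \<circ> \<sigma> = act_obj d h f" for h
    using \<sigma>d by (auto simp: act_obj_def compose_def fun_eq_iff gf[symmetric])
  show ?thesis
  proof
    assume "(f', \<sigma>', g') \<in> mor_orbit l k d (f, \<sigma>, g)"
    then obtain h where h: "h \<in> H" "f' = act_obj d h f" "\<sigma>' = \<sigma>" "g' = act_obj d h g"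
      by (auto simp: mor_orbit_def)
    then show "\<sigma>' = \<sigma> \<and> (f', \<sigma>, g') \<in> gpd_mor l d \<and> same_orbit f' f"
      using same_orbit_iff[OF act_obj_closed[OF h(1) f] f] act_obj_closed[OF h(1)] f g \<sigma> comp
      by (auto simp: gpd_mor_def)
  next
    assume *: "\<sigma>' = \<sigma> \<and> (f', \<sigma>, g') \<in> gpd_mor l d \<and> same_orbit f' f"
    then have f': "f' \<in> gpd_obj l d" and g': "g' \<in> gpd_obj l d" and gf': "g' \<circ> \<sigma> = f'"
      by (auto simp: gpd_mor_def)
    then obtain h where h: "h \<in> H" "f' = act_obj d h f" using * same_orbit_iff f by blast
    have "g' \<circ> \<sigma> = act_obj d h g \<circ> \<sigma>" using gf' comp h by simp
    then have "g' = act_obj d h g" using permutes_surj[OF \<sigma>] by (metis surj_fun_eq)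
    then show "(f', \<sigma>', g') \<in> mor_orbit l k d (f, \<sigma>, g)"
      using h * by (force simp: mor_orbit_def)
  qed
qed

lemma mor_orbit_eq_iff:
  assumes "(f, \<sigma>, g) \<in> gpd_mor l d" "(f', \<sigma>', g') \<in> gpd_mor l d"
  shows "mor_orbit l k d (f', \<sigma>', g') = mor_orbit l k d (f, \<sigma>, g) \<longleftrightarrow> \<sigma>' = \<sigma> \<and> same_orbit f' f"
proof
  assume "mor_orbit l k d (f', \<sigma>', g') = mor_orbit l k d (f, \<sigma>, g)"
  moreover have "(f', \<sigma>', g') \<in> mor_orbit l k d (f', \<sigma>', g')"
    using mem_mor_orbit_iff[OF assms(2)] assms(2) by simp
  ultimately show "\<sigma>' = \<sigma> \<and> same_orbit f' f" using mem_mor_orbit_iff[OF assms(1)] by simp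
next
  assume *: "\<sigma>' = \<sigma> \<and> same_orbit f' f"
  have "x \<in> mor_orbit l k d (f', \<sigma>', g') \<longleftrightarrow> x \<in> mor_orbit l k d (f, \<sigma>, g)" for x
  proof (cases x)
    case (fields a b c)
    show ?thesis
      unfolding fields mem_mor_orbit_iff[OF assms(1)] mem_mor_orbit_iff[OF assms(2)]
      using * same_orbit_trans same_orbit_sym by blast
  qed
  then show "mor_orbit l k d (f', \<sigma>', g') = mor_orbit l k d (f, \<sigma>, g)" by blast
qed

section \<open>Morphisms attached to permuted multi-indices\<close>

lemma block_type_obj: "I \<in> MI \<Longrightarrow> block_type I \<in> gpd_obj l d"
  using div_m_less by (auto simp: block_type_def gpd_obj_def multi_indices_def)

lemma block_type_comp:
  assumes "\<sigma> permutes {..<d}"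
  shows "block_type I \<circ> \<sigma> = block_type (I \<circ> \<sigma>)"
  using permutes_in_image[OF assms] by (auto simp: block_type_def fun_eq_iff)

text \<open>This is the morphism over \<sigma> that carries the basis tensor of
  \<open>I \<circ> \<sigma>\<close> to that of \<open>I\<close>.\<close>

lemma block_type_mor:
  assumes "I \<in> MI" "\<sigma> permutes {..<d}"
  shows "(block_type (I \<circ> \<sigma>), \<sigma>, block_type I) \<in> gpd_mor l d"
  using assms block_type_obj comp_multi_index block_type_comp by (auto simp: gpd_mor_def)

section \<open>The quotient algebra as matrices\<close>

lemma finite_gpd_mor: "finite (gpd_mor l d)"
proof (rule finite_subset)
  show "gpd_mor l d \<subseteq> gpd_obj l d \<times> {\<sigma>. \<sigma> permutes {..<d}} \<times> gpd_obj l d"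
    by (auto simp: gpd_mor_def)
  show "finite (gpd_obj l d \<times> {\<sigma>. \<sigma> permutes {..<d}} \<times> gpd_obj l d)"
    by (intro finite_cartesian_product finite_permutes) (simp_all add: gpd_obj_def finite_PiE)
qed

lemma carrier_quot_algebra:
  "carrier (quot_algebra l k d) = {a. {x. a x \<noteq> 0} \<subseteq> quot_mor l k d}"
proof -
  have "finite (quot_mor l k d)" by (simp add: quot_mor_def finite_gpd_mor)
  then show ?thesis using finite_subset by (auto simp: quot_algebra_def basis_algebra_def)
qed

text \<open>The orbits partition the morphisms, so at most one summand of the embedding contains
  \<open>x\<close>.\<close>

lemma quot_embedding_eq:
  assumes "a \<in> carrier (quot_algebra l k d)"
  shows "quot_embedding a x = (if x \<in> gpd_mor l d then a (mor_orbit l k d x) else 0)"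
proof -
  have unique: "x \<in> gpd_mor l d \<and> X = mor_orbit l k d x" if X: "X \<in> quot_mor l k d" "x \<in> X" for X
  proof -
    obtain f \<sigma> g where y: "(f, \<sigma>, g) \<in> gpd_mor l d" "X = mor_orbit l k d (f, \<sigma>, g)"
      using X(1) by (auto simp: quot_mor_def)
    obtain f' \<sigma>' g' where x: "x = (f', \<sigma>', g')" by (cases x)
    have mor: "\<sigma>' = \<sigma>" "(f', \<sigma>, g') \<in> gpd_mor l d" "same_orbit f' f"
      using X(2) unfolding x y(2) mem_mor_orbit_iff[OF y(1)] by auto
    then show ?thesis using mor_orbit_eq_iff[OF y(1) mor(2)] by (simp add: x y(2))
  qed
  have self: "x \<in> mor_orbit l k d x" if "x \<in> gpd_mor l d"
    using that mem_mor_orbit_iff by (cases x) auto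
  have "{X. a X \<noteq> 0 \<and> x \<in> X} =
      (if x \<in> gpd_mor l d \<and> a (mor_orbit l k d x) \<noteq> 0 then {mor_orbit l k d x} else {})"
    using assms unique self unfolding carrier_quot_algebra by auto
  then show ?thesis by (simp add: quot_embedding_def)
qed

definition quot_matrix :: "(gmor set \<Rightarrow> complex) \<Rightarrow> (nat \<Rightarrow> nat) \<Rightarrow> (nat \<Rightarrow> nat) \<Rightarrow> complex" where
  "quot_matrix a I J = (\<Sum>\<sigma> | \<sigma> permutes {..<d}.
     if I \<circ> \<sigma> = J then a (mor_orbit l k d (block_type J, \<sigma>, block_type I)) else 0)"

text \<open>At coordinate \<open>I\<close> a morphism over \<sigma> reads \<open>t\<close> at
  \<open>I \<circ> \<sigma>\<close>, which the block projection kills unless the source is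
  \<open>block_type (I \<circ> \<sigma>)\<close>; the target is then forced. This leaves one term
  per permutation.\<close>

lemma quot_algebra_action_eq:
  assumes "a \<in> carrier (quot_algebra l k d)"
  shows "quot_algebra_action l d m a = tensor_op n d (quot_matrix a)"
proof
  fix t
  let ?b = "quot_embedding a"
  have b: "?b x = (if x \<in> gpd_mor l d then a (mor_orbit l k d x) else 0)" for x
    by (rule quot_embedding_eq[OF assms])
  have "(\<Sum>x | ?b x \<noteq> 0. ?b x * gmor_action l d m x t I) = tensor_op n d (quot_matrix a) t I"
    if t: "t \<in> tensors n d" for I
  proof -
    have "(\<Sum>x | ?b x \<noteq> 0. ?b x * gmor_action l d m x t I) =
        (\<Sum>x\<in>gpd_mor l d. ?b x * gmor_action l d m x t I)"
      by (rule sum.mono_neutral_left[OF finite_gpd_mor]) (auto simp: b)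
    also have "\<dots> = tensor_op n d (quot_matrix a) t I"
    proof (cases "I \<in> MI")
      case False
      have "gmor_action l d m (f, \<sigma>, g) t I = 0" if "(f, \<sigma>, g) \<in> gpd_mor l d" for f \<sigma> g
      proof -
        have "I \<circ> \<sigma> \<notin> MI" using that False permute_multi_index by (auto simp: gpd_mor_def)
        then show ?thesis using t by (simp add: block_projection_def tensors_def)
      qed
      then have "(\<Sum>x\<in>gpd_mor l d. ?b x * gmor_action l d m x t I) = 0"
        by (intro sum.neutral) auto
      then show ?thesis using t False by (simp add: tensor_op_def)
    next
      case True
      let ?x = "\<lambda>\<sigma>. (block_type (I \<circ> \<sigma>), \<sigma>, block_type I)"
      have "(\<Sum>x\<in>gpd_mor l d. ?b x * gmor_action l d m x t I) =
          (\<Sum>x\<in>?x ` {\<sigma>. \<sigma> permutes {..<d}}. ?b x * gmor_action l d m x t I)"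
      proof (rule sum.mono_neutral_right[OF finite_gpd_mor])
        show "?x ` {\<sigma>. \<sigma> permutes {..<d}} \<subseteq> gpd_mor l d" using block_type_mor[OF True] by auto
        show "\<forall>x\<in>gpd_mor l d - ?x ` {\<sigma>. \<sigma> permutes {..<d}}. ?b x * gmor_action l d m x t I = 0"
        proof
          fix x assume x: "x \<in> gpd_mor l d - ?x ` {\<sigma>. \<sigma> permutes {..<d}}"
          obtain f \<sigma> g where fg: "x = (f, \<sigma>, g)" by (cases x)
          have fo: "f \<in> gpd_obj l d" and \<sigma>: "\<sigma> permutes {..<d}" and gf: "g \<circ> \<sigma> = f"
            using x by (auto simp: gpd_mor_def fg)
          have "\<not> (\<forall>i<d. (I \<circ> \<sigma>) i div m = f i)"
          proof
            assume "\<forall>i<d. (I \<circ> \<sigma>) i div m = f i"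
            then have "f = block_type (I \<circ> \<sigma>)"
              using fo by (auto simp: block_type_def gpd_obj_def fun_eq_iff PiE_iff extensional_def)
            moreover from this have "g = block_type I"
              using gf block_type_comp[OF \<sigma>, of I] permutes_surj[OF \<sigma>] by (metis surj_fun_eq)
            ultimately show False using x \<sigma> fg by auto
          qed
          then have "gmor_action l d m x t I = 0"
            unfolding fg using t by (auto simp: block_projection_def simp del: o_apply)
          then show "?b x * gmor_action l d m x t I = 0" by simp
        qed
      qed
      also have "\<dots> = (\<Sum>\<sigma> | \<sigma> permutes {..<d}. ?b (?x \<sigma>) * gmor_action l d m (?x \<sigma>) t I)"
        by (subst sum.reindex) (auto simp: inj_on_def)
      also have "\<dots> = (\<Sum>\<sigma> | \<sigma> permutes {..<d}. a (mor_orbit l k d (?x \<sigma>)) * t (I \<circ> \<sigma>))"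
      proof (rule sum.cong[OF refl])
        fix \<sigma> assume "\<sigma> \<in> {\<sigma>. \<sigma> permutes {..<d}}"
        then show "?b (?x \<sigma>) * gmor_action l d m (?x \<sigma>) t I = a (mor_orbit l k d (?x \<sigma>)) * t (I \<circ> \<sigma>)"
          using block_type_mor[OF True] t by (simp add: b block_projection_def block_type_def)
      qed
      also have "\<dots> = (\<Sum>\<sigma> | \<sigma> permutes {..<d}. \<Sum>J\<in>MI. if J = I \<circ> \<sigma> then
          a (mor_orbit l k d (block_type J, \<sigma>, block_type I)) * t J else 0)"
        using comp_multi_index[OF _ True] by (intro sum.cong) auto
      also have "\<dots> = (\<Sum>J\<in>MI. quot_matrix a I J * t J)"
        unfolding quot_matrix_def sum_distrib_right by (subst sum.swap) (intro sum.cong refl, auto)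
      finally show ?thesis using t True by (simp add: tensor_op_def)
    qed
    finally show ?thesis .
  qed
  then show "quot_algebra_action l d m a t = tensor_op n d (quot_matrix a) t"
    by (cases "t \<in> tensors n d")
      (simp_all add: quot_algebra_action_def gpd_algebra_action_def linear_extension_def,
        simp add: tensor_op_def)
qed

section \<open>The double centralizer property\<close>

definition equivariant :: "((nat \<Rightarrow> nat) \<Rightarrow> (nat \<Rightarrow> nat) \<Rightarrow> complex) \<Rightarrow> bool" where
  "equivariant Y \<longleftrightarrow> (\<forall>I\<in>MI. \<forall>J\<in>MI.
     (Y I J \<noteq> 0 \<longrightarrow> same_orbit (block_type I) (block_type J)) \<and>
     (\<forall>\<sigma>. \<sigma> permutes {..<d} \<longrightarrow> Y (I \<circ> \<sigma>) (J \<circ> \<sigma>) = Y I J))"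

section \<open>Equivariance and commutation with the quotient algebra\<close>

lemma comp_cancel:
  assumes "\<sigma> permutes {..<d}"
  shows "K \<circ> \<sigma> = J \<longleftrightarrow> K = J \<circ> inv_into UNIV \<sigma>"
  using permutes_inv_o[OF assms] by (metis comp_assoc comp_id)

lemma same_orbit_comp:
  assumes "\<sigma> permutes {..<d}" "same_orbit f g"
  shows "same_orbit (f \<circ> \<sigma>) (g \<circ> \<sigma>)"
  using assms(2) permutes_in_image[OF assms(1)] by (auto simp: same_orbit_def)

text \<open>Both products become sums over \<sigma> and agree term by term. With
  \<open>J = L \<circ> \<sigma>\<close>, invariance equates the entries of \<open>Y\<close>, and
  where these are nonzero the support condition puts both morphisms over \<sigma> in one orbit, so
  the coefficients agree.\<close>

lemma equivariant_commutes:
  assumes Y: "equivariant Y" and a: "a \<in> carrier (quot_algebra l k d)"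
  shows "tensor_op n d Y \<otimes>\<^bsub>End_tensors n d\<^esub> quot_algebra_action l d m a =
    quot_algebra_action l d m a \<otimes>\<^bsub>End_tensors n d\<^esub> tensor_op n d Y"
  unfolding quot_algebra_action_eq[OF a] tensor_op_commute_iff
proof (intro ballI)
  fix I J assume I: "I \<in> MI" and J: "J \<in> MI"
  let ?orb = "\<lambda>f \<sigma> g. a (mor_orbit l k d (f, \<sigma>, g))"
  have "(\<Sum>K\<in>MI. Y I K * quot_matrix a K J) =
      (\<Sum>\<sigma> | \<sigma> permutes {..<d}. \<Sum>K\<in>MI. if K = J \<circ> inv_into UNIV \<sigma> then
        Y I K * ?orb (block_type J) \<sigma> (block_type K) else 0)"
    unfolding quot_matrix_def sum_distrib_left
    by (subst sum.swap) (auto simp: comp_cancel intro!: sum.cong)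
  also have "\<dots> = (\<Sum>\<sigma> | \<sigma> permutes {..<d}.
      Y I (J \<circ> inv_into UNIV \<sigma>) * ?orb (block_type J) \<sigma> (block_type (J \<circ> inv_into UNIV \<sigma>)))"
    using comp_multi_index[OF permutes_inv J] by (intro sum.cong) auto
  also have "\<dots> = (\<Sum>\<sigma> | \<sigma> permutes {..<d}.
      ?orb (block_type (I \<circ> \<sigma>)) \<sigma> (block_type I) * Y (I \<circ> \<sigma>) J)"
  proof (rule sum.cong[OF refl])
    fix \<sigma> assume "\<sigma> \<in> {\<sigma>. \<sigma> permutes {..<d}}"
    then have \<sigma>: "\<sigma> permutes {..<d}" by simp
    define L where "L = J \<circ> inv_into UNIV \<sigma>"
    have L: "L \<in> MI" using comp_multi_index[OF permutes_inv[OF \<sigma>] J] by (simp add: L_def)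
    have JL: "J = L \<circ> \<sigma>" using comp_cancel[OF \<sigma>, of L J] by (simp add: L_def)
    have "Y I L = Y (I \<circ> \<sigma>) J" using Y I L \<sigma> by (simp add: equivariant_def JL)
    moreover have "?orb (block_type J) \<sigma> (block_type L) = ?orb (block_type (I \<circ> \<sigma>)) \<sigma> (block_type I)"
      if "Y I L \<noteq> 0"
    proof -
      have "same_orbit (block_type I) (block_type L)" using that Y I L by (auto simp: equivariant_def)
      from same_orbit_comp[OF \<sigma> this]
      have "same_orbit (block_type (I \<circ> \<sigma>)) (block_type J)" by (simp add: block_type_comp[OF \<sigma>] JL)
      then show ?thesis
        using mor_orbit_eq_iff[OF block_type_mor[OF L \<sigma>] block_type_mor[OF I \<sigma>]] by (simp add: JL)
    qed
    ultimately show "Y I (J \<circ> inv_into UNIV \<sigma>) * ?orb (block_type J) \<sigma> (block_type (J \<circ> inv_into UNIV \<sigma>)) =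
        ?orb (block_type (I \<circ> \<sigma>)) \<sigma> (block_type I) * Y (I \<circ> \<sigma>) J"
      by (cases "Y I L = 0") (simp_all flip: L_def)
  qed
  also have "\<dots> = (\<Sum>\<sigma> | \<sigma> permutes {..<d}. \<Sum>K\<in>MI. if K = I \<circ> \<sigma> then
      ?orb (block_type K) \<sigma> (block_type I) * Y K J else 0)"
    using comp_multi_index[OF _ I] by (intro sum.cong) auto
  also have "\<dots> = (\<Sum>K\<in>MI. quot_matrix a I K * Y K J)"
    unfolding quot_matrix_def sum_distrib_right by (subst sum.swap) (intro sum.cong refl, auto)
  finally show "(\<Sum>K\<in>MI. Y I K * quot_matrix a K J) = (\<Sum>K\<in>MI. quot_matrix a I K * Y K J)" .
qed

text \<open>The test element is the single orbit of the morphism over \<sigma> with target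
  \<open>block_type J\<close>. Commutation, read at the entry
  \<open>(I, J \<circ> \<sigma>)\<close>, leaves one term on each side and yields
  \<open>key\<close>, which contains both the support and the invariance condition.\<close>

lemma commutes_equivariant:
  assumes "\<And>a. a \<in> carrier (quot_algebra l k d) \<Longrightarrow>
    tensor_op n d Y \<otimes>\<^bsub>End_tensors n d\<^esub> quot_algebra_action l d m a =
    quot_algebra_action l d m a \<otimes>\<^bsub>End_tensors n d\<^esub> tensor_op n d Y"
  shows "equivariant Y"
proof -
  have key: "Y I J = (if same_orbit (block_type (I \<circ> \<sigma>)) (block_type (J \<circ> \<sigma>)) then Y (I \<circ> \<sigma>) (J \<circ> \<sigma>) else 0)"
    if I: "I \<in> MI" and J: "J \<in> MI" and \<sigma>: "\<sigma> permutes {..<d}" for I J \<sigma>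
  proof -
    have J\<sigma>: "J \<circ> \<sigma> \<in> MI" and I\<sigma>: "I \<circ> \<sigma> \<in> MI" using comp_multi_index[OF \<sigma>] I J by auto
    let ?x = "(block_type (J \<circ> \<sigma>), \<sigma>, block_type J)"
    have x: "?x \<in> gpd_mor l d" by (rule block_type_mor[OF J \<sigma>])
    define a :: "gmor set \<Rightarrow> complex" where "a X = of_bool (X = mor_orbit l k d ?x)" for X
    have a: "a \<in> carrier (quot_algebra l k d)"
      using imageI[OF x, of "mor_orbit l k d"]
      by (simp add: carrier_quot_algebra a_def quot_mor_def)
    have X: "quot_matrix a K L = of_bool (K \<circ> \<sigma> = L \<and> same_orbit (block_type L) (block_type (J \<circ> \<sigma>)))"
      if K: "K \<in> MI" for K L
    proof -
      have "(if K \<circ> \<tau> = L then a (mor_orbit l k d (block_type L, \<tau>, block_type K)) else 0) =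
          (if \<tau> = \<sigma> then of_bool (K \<circ> \<sigma> = L \<and> same_orbit (block_type L) (block_type (J \<circ> \<sigma>))) else 0)"
        if \<tau>: "\<tau> permutes {..<d}" for \<tau>
      proof (cases "K \<circ> \<tau> = L")
        case True
        have "a (mor_orbit l k d (block_type L, \<tau>, block_type K)) =
            of_bool (\<tau> = \<sigma> \<and> same_orbit (block_type L) (block_type (J \<circ> \<sigma>)))"
          unfolding a_def True[symmetric] mor_orbit_eq_iff[OF x block_type_mor[OF K \<tau>]] ..
        then show ?thesis using True by (cases "\<tau> = \<sigma>") simp_all
      next
        case False
        then show ?thesis by auto
      qed
      then have "quot_matrix a K L = (\<Sum>\<tau> | \<tau> permutes {..<d}. if \<tau> = \<sigma> then
          of_bool (K \<circ> \<sigma> = L \<and> same_orbit (block_type L) (block_type (J \<circ> \<sigma>))) else 0)"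
        unfolding quot_matrix_def by (intro sum.cong) auto
      then show ?thesis using \<sigma> finite_permutes by simp
    qed
    have "Y I J = (\<Sum>K\<in>MI. if K = J then Y I K else 0)" using J by simp
    also have "\<dots> = (\<Sum>K\<in>MI. Y I K * quot_matrix a K (J \<circ> \<sigma>))"
    proof (rule sum.cong[OF refl])
      fix K assume "K \<in> MI"
      moreover have "K \<circ> \<sigma> = J \<circ> \<sigma> \<longleftrightarrow> K = J"
        using comp_cancel[OF \<sigma>, of K "J \<circ> \<sigma>"] comp_cancel[OF \<sigma>, of J "J \<circ> \<sigma>"] by auto
      ultimately show "(if K = J then Y I K else 0) = Y I K * quot_matrix a K (J \<circ> \<sigma>)" by (simp add: X)
    qed
    also have "\<dots> = (\<Sum>K\<in>MI. quot_matrix a I K * Y K (J \<circ> \<sigma>))"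
      using assms[OF a] I J\<sigma> unfolding quot_algebra_action_eq[OF a] tensor_op_commute_iff by blast
    also have "\<dots> = (\<Sum>K\<in>MI. if K = I \<circ> \<sigma> then
        of_bool (same_orbit (block_type K) (block_type (J \<circ> \<sigma>))) * Y K (J \<circ> \<sigma>) else 0)"
      by (intro sum.cong) (auto simp: X[OF I])
    finally show ?thesis using I\<sigma> by simp
  qed
  have support: "same_orbit (block_type I) (block_type J)" if "I \<in> MI" "J \<in> MI" "Y I J \<noteq> 0" for I J
    using key[OF that(1,2) permutes_id] that(3) unfolding comp_id by metis
  \<comment> \<open>The case distinction in \<open>key\<close> disappears: when the permuted types
    lie in different orbits, \<open>support\<close> makes
    \<open>Y (I \<circ> \<sigma>) (J \<circ> \<sigma>)\<close> zero as well.\<close>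
  have "Y (I \<circ> \<sigma>) (J \<circ> \<sigma>) = Y I J" if "I \<in> MI" "J \<in> MI" "\<sigma> permutes {..<d}" for I J \<sigma>
    using key[OF that] support[OF comp_multi_index[OF that(3,1)] comp_multi_index[OF that(3,2)]]
    by metis
  then show ?thesis unfolding equivariant_def using support by blast
qed

section \<open>Equivariant matrices and the span of the group\<close>

lemma equivariant_GLZ_action:
  assumes a: "a \<in> carrier (group_algebra (GLZ l m))"
  shows "equivariant (\<lambda>I J. \<Sum>x | a x \<noteq> 0. a x * GLZ_power x I J)"
proof -
  have "same_orbit (block_type I) (block_type J)"
    if IJ: "I \<in> MI" "J \<in> MI" and nz: "(\<Sum>x | a x \<noteq> 0. a x * GLZ_power x I J) \<noteq> 0" for I J
  proof -
    obtain x where "a x \<noteq> 0" and x: "GLZ_power x I J \<noteq> 0"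
      using nz by (metis (mono_tags, lifting) mem_Collect_eq mult_zero_right sum.neutral)
    then have "x \<in> carrier (GLZ l m)" using a by (auto simp: carrier_group_algebra_GLZ)
    then obtain z where z: "graded z (GLZ_matrix l k m x)" using GLZ_matrix_graded by blast
    \<comment> \<open>The degree of one group element serves all tensor positions, as
      \<open>same_orbit\<close> demands.\<close>
    have "[int (I p div m) = int (J p div m) + z * int r] (mod int l)" if "p < d" for p
    proof -
      have "GLZ_matrix l k m x $$ (I p, J p) \<noteq> 0" using x that by auto
      moreover have "I p < n" "J p < n" using IJ that by (auto simp: multi_indices_def)
      ultimately show ?thesis using z by (auto simp: graded_def)
    qed
    then show ?thesis by (auto simp: same_orbit_def block_type_def)
  qed
  moreover have sym: "GLZ_power x (I \<circ> \<sigma>) (J \<circ> \<sigma>) = GLZ_power x I J" if "\<sigma> permutes {..<d}" for x I J \<sigma>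
    using prod.permute[OF that, of "\<lambda>p. GLZ_matrix l k m x $$ (I p, J p)"] by (simp add: o_def)
  ultimately show ?thesis
    unfolding equivariant_def by (intro ballI conjI allI impI) (blast, simp only: sym)
qed

text \<open>In the sum of all \<open>Y I J * symmetrized_unit I J\<close>, invariance makes every
  permutation contribute the same entry of \<open>Y\<close>; this explains the factor
  \<open>1 / fact d\<close>.\<close>

lemma equivariant_spanned:
  assumes Y: "equivariant Y"
  shows "spanned Y"
proof -
  define F where "F = {(I, J). I \<in> MI \<and> J \<in> MI \<and> same_orbit (block_type I) (block_type J)}"
  have sub: "F \<subseteq> MI \<times> MI" by (auto simp: F_def)
  then have fin: "finite F" by (rule finite_subset) simp
  have "spanned (symmetrized_unit (fst x) (snd x))" if "x \<in> F" for x
    using that spanned_symmetrized_unit by (auto simp: F_def)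
  then have "spanned (\<lambda>K L. \<Sum>x\<in>F. Y (fst x) (snd x) / fact d * symmetrized_unit (fst x) (snd x) K L)"
    by (rule spanned_sum[where Y = "\<lambda>x. symmetrized_unit (fst x) (snd x)"
          and c = "\<lambda>x. Y (fst x) (snd x) / fact d", OF fin])
  then have "spanned (\<lambda>K L. \<Sum>(I, J)\<in>F. Y I J / fact d * symmetrized_unit I J K L)"
    by (simp only: case_prod_unfold)
  then show ?thesis
  proof (rule spanned_cong)
    fix K L assume KL: "K \<in> MI" "L \<in> MI"
    \<comment> \<open>The sum may be extended to all pairs because \<open>Y\<close> vanishes outside
      \<open>F\<close>.\<close>
    have "(\<Sum>(I, J)\<in>F. Y I J / fact d * symmetrized_unit I J K L) =
        (\<Sum>(I, J)\<in>MI \<times> MI. Y I J / fact d * symmetrized_unit I J K L)"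
      using Y by (intro sum.mono_neutral_left sub) (auto simp: F_def equivariant_def)
    also have "\<dots> = (\<Sum>\<sigma> | \<sigma> permutes {..<d}. \<Sum>x\<in>MI \<times> MI.
        if x = (K \<circ> inv_into UNIV \<sigma>, L \<circ> inv_into UNIV \<sigma>) then Y (fst x) (snd x) / fact d else 0)"
      unfolding symmetrized_unit_def case_prod_unfold sum_distrib_left
    proof (subst sum.swap, intro sum.cong refl)
      fix \<sigma> x assume "\<sigma> \<in> {\<sigma>. \<sigma> permutes {..<d}}"
      then have \<sigma>: "\<sigma> permutes {..<d}" by simp
      show "Y (fst x) (snd x) / fact d * of_bool (K = fst x \<circ> \<sigma> \<and> L = snd x \<circ> \<sigma>) =
          (if x = (K \<circ> inv_into UNIV \<sigma>, L \<circ> inv_into UNIV \<sigma>) then Y (fst x) (snd x) / fact d else 0)"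
        using comp_cancel[OF \<sigma>, of "fst x" K] comp_cancel[OF \<sigma>, of "snd x" L]
        by (cases x) auto
    qed
    also have "\<dots> = (\<Sum>\<sigma> | \<sigma> permutes {..<d}. Y K L / fact d)"
    proof (rule sum.cong[OF refl])
      fix \<sigma> assume "\<sigma> \<in> {\<sigma>. \<sigma> permutes {..<d}}"
      then have \<sigma>: "inv_into UNIV \<sigma> permutes {..<d}" by (simp add: permutes_inv)
      have "Y (K \<circ> inv_into UNIV \<sigma>) (L \<circ> inv_into UNIV \<sigma>) = Y K L" using Y KL \<sigma> by (simp add: equivariant_def)
      then show "(\<Sum>x\<in>MI \<times> MI. if x = (K \<circ> inv_into UNIV \<sigma>, L \<circ> inv_into UNIV \<sigma>) then Y (fst x) (snd x) / fact d else 0) =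
          Y K L / fact d"
        using comp_multi_index[OF \<sigma>] KL by simp
    qed
    also have "\<dots> = Y K L" by (simp add: card_permutations[of _ d])
    finally show "(\<Sum>(I, J)\<in>F. Y I J / fact d * symmetrized_unit I J K L) = Y K L" .
  qed
qed

section \<open>The commutant of the group action\<close>

definition injective_index :: "(nat \<Rightarrow> nat) \<Rightarrow> nat \<Rightarrow> nat" where
  "injective_index f = (\<lambda>i\<in>{..<d}. f i * m + i)"

text \<open>The offset \<open>i < d \<le> m\<close> keeps entry \<open>i\<close> inside block
  \<open>f i\<close>.\<close>

lemma injective_index:
  assumes "f \<in> gpd_obj l d"
  shows "injective_index f \<in> MI" "block_type (injective_index f) = f"
proof -
  have "f i * m + i < n" if "i < d" for i
  proof -
    have "f i < l" using assms that by (auto simp: gpd_obj_def)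
    then have "Suc (f i) * m \<le> n" by (intro mult_le_mono1) simp
    then show ?thesis using that m_ge by simp
  qed
  then show "injective_index f \<in> MI" by (auto simp: injective_index_def multi_indices_def)
  have "(f i * m + i) div m = f i" if "i < d" for i using that m_ge by simp
  then show "block_type (injective_index f) = f"
    using PiE_arb[OF assms[unfolded gpd_obj_def]]
    by (intro ext) (simp add: injective_index_def block_type_def)
qed

text \<open>Reduction modulo \<open>m\<close> recovers the position from the entry, even if
  \<open>f\<close> repeats values.\<close>

lemma injective_index_comp_eq_iff:
  assumes "\<sigma> permutes {..<d}" "\<tau> permutes {..<d}"
  shows "injective_index f \<circ> \<sigma> = injective_index f \<circ> \<tau> \<longleftrightarrow> \<sigma> = \<tau>"
proof
  assume eq: "injective_index f \<circ> \<sigma> = injective_index f \<circ> \<tau>"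
  have mod: "injective_index f i mod m = i" if "i < d" for i using that m_ge by (simp add: injective_index_def)
  show "\<sigma> = \<tau>"
  proof
    fix i
    show "\<sigma> i = \<tau> i"
    proof (cases "i < d")
      case True
      then have "\<sigma> i < d" "\<tau> i < d" using permutes_in_image[OF assms(1)] permutes_in_image[OF assms(2)] by auto
      then show ?thesis using fun_cong[OF eq, of i] mod by (metis comp_apply)
    next
      case False
      then show ?thesis using permutes_not_in[OF assms(1)] permutes_not_in[OF assms(2)] by simp
    qed
  qed
qed simp

text \<open>Commutation with the symmetrized unit of \<open>I\<close> and \<open>?J f\<close>, read
  at the entry \<open>(K, ?J f)\<close>, expresses column \<open>I\<close> of \<open>X\<close>
  through the single column \<open>?J f\<close>. The entries of that column become the coefficients
  of \<open>a\<close>.\<close>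

lemma commutes_quot_matrix:
  assumes comm: "\<And>Y. spanned Y \<Longrightarrow> tensor_op n d X \<otimes>\<^bsub>End_tensors n d\<^esub> tensor_op n d Y =
    tensor_op n d Y \<otimes>\<^bsub>End_tensors n d\<^esub> tensor_op n d X"
  obtains a where "a \<in> carrier (quot_algebra l k d)" "tensor_op n d X = tensor_op n d (quot_matrix a)"
proof -
  let ?J = injective_index
  have key: "X K I = (\<Sum>\<sigma> | \<sigma> permutes {..<d}. of_bool (K = I \<circ> \<sigma>) * X (?J f \<circ> \<sigma>) (?J f))"
    if K: "K \<in> MI" and I: "I \<in> MI" and f: "f \<in> gpd_obj l d" and orb: "same_orbit (block_type I) f" for K I f
  proof -
    have Jf: "?J f \<in> MI" by (rule injective_index[OF f])
    have "spanned (symmetrized_unit I (?J f))"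
      using I Jf orb injective_index(2)[OF f] by (intro spanned_symmetrized_unit) auto
    from comm[OF this]
    have eq: "(\<Sum>L\<in>MI. X K L * symmetrized_unit I (?J f) L (?J f)) =
        (\<Sum>L\<in>MI. symmetrized_unit I (?J f) K L * X L (?J f))"
      using K Jf by (simp add: tensor_op_commute_iff)
    \<comment> \<open>The entries of \<open>?J f\<close> are distinct, so only the identity fixes
      it.\<close>
    have unit: "symmetrized_unit I (?J f) L (?J f) = of_bool (L = I)" for L
    proof -
      have "symmetrized_unit I (?J f) L (?J f) = (\<Sum>\<sigma> | \<sigma> permutes {..<d}. if \<sigma> = id then of_bool (L = I) else 0)"
        unfolding symmetrized_unit_def
      proof (intro sum.cong refl)
        fix \<sigma> assume "\<sigma> \<in> {\<sigma>. \<sigma> permutes {..<d}}"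
        then have "?J f = ?J f \<circ> \<sigma> \<longleftrightarrow> \<sigma> = id"
          using injective_index_comp_eq_iff[OF permutes_id, of \<sigma> f] by auto
        then show "of_bool (L = I \<circ> \<sigma> \<and> ?J f = ?J f \<circ> \<sigma>) = (if \<sigma> = id then of_bool (L = I) else 0)"
          by (cases "\<sigma> = id") auto
      qed
      then show ?thesis using finite_permutes permutes_id by simp
    qed
    have "X K I = (\<Sum>L\<in>MI. if L = I then X K L else 0)" using I by simp
    also have "\<dots> = (\<Sum>L\<in>MI. X K L * symmetrized_unit I (?J f) L (?J f))"
      by (intro sum.cong) (simp_all add: unit)
    also have "\<dots> = (\<Sum>\<sigma> | \<sigma> permutes {..<d}. \<Sum>L\<in>MI. if L = ?J f \<circ> \<sigma> then
        of_bool (K = I \<circ> \<sigma>) * X L (?J f) else 0)"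
      unfolding eq
      unfolding symmetrized_unit_def sum_distrib_right by (subst sum.swap) (intro sum.cong refl, auto)
    also have "\<dots> = (\<Sum>\<sigma> | \<sigma> permutes {..<d}. of_bool (K = I \<circ> \<sigma>) * X (?J f \<circ> \<sigma>) (?J f))"
      using comp_multi_index[OF _ Jf] by (intro sum.cong) auto
    finally show ?thesis .
  qed
  \<comment> \<open>The inverse appears because \<open>quot_matrix\<close> tests
    \<open>I \<circ> \<sigma> = J\<close>, whereas \<open>key\<close> tests
    \<open>K = I \<circ> \<sigma>\<close>.\<close>
  define coef where "coef = (\<lambda>(f, \<tau>, g :: nat \<Rightarrow> nat). X (?J f \<circ> inv_into UNIV \<tau>) (?J f))"
  define a where "a Q = (if Q \<in> quot_mor l k d then coef (SOME x. x \<in> Q) else 0)" for Q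
  have a: "a \<in> carrier (quot_algebra l k d)" by (auto simp: carrier_quot_algebra a_def)
  have a_orbit: "a (mor_orbit l k d (f, \<tau>, g)) = X (?J f \<circ> inv_into UNIV \<tau>) (?J f)"
    if x: "(f, \<tau>, g) \<in> gpd_mor l d" for f \<tau> g
  proof -
    have "(f, \<tau>, g) \<in> mor_orbit l k d (f, \<tau>, g)" using mem_mor_orbit_iff[OF x] x by simp
    then have "(SOME x. x \<in> mor_orbit l k d (f, \<tau>, g)) \<in> mor_orbit l k d (f, \<tau>, g)" by (rule someI)
    then obtain f' g' where f': "(SOME x. x \<in> mor_orbit l k d (f, \<tau>, g)) = (f', \<tau>, g')"
      "(f', \<tau>, g') \<in> gpd_mor l d" "same_orbit f' f"
      using mem_mor_orbit_iff[OF x] by (metis prod_cases3)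
    then have obj: "f \<in> gpd_obj l d" "f' \<in> gpd_obj l d" and \<tau>: "inv_into UNIV \<tau> permutes {..<d}"
      using x permutes_inv by (auto simp: gpd_mor_def)
    \<comment> \<open>The chosen representative may have another source \<open>f'\<close>. Applying
      \<open>key\<close> to column \<open>?J f'\<close> with reference column \<open>?J f\<close>
      shows that both give the same coefficient.\<close>
    have J: "?J f' \<in> MI" "block_type (?J f') = f'" using injective_index[OF obj(2)] by auto
    have "X (?J f' \<circ> inv_into UNIV \<tau>) (?J f') =
        (\<Sum>\<sigma> | \<sigma> permutes {..<d}. of_bool (?J f' \<circ> inv_into UNIV \<tau> = ?J f' \<circ> \<sigma>) * X (?J f \<circ> \<sigma>) (?J f))"
      using key[OF comp_multi_index[OF \<tau> J(1)] J(1) obj(1)] f'(3) J(2) by simp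
    also have "\<dots> = (\<Sum>\<sigma> | \<sigma> permutes {..<d}. if \<sigma> = inv_into UNIV \<tau> then X (?J f \<circ> \<sigma>) (?J f) else 0)"
      by (intro sum.cong) (auto simp: injective_index_comp_eq_iff[OF \<tau>])
    also have "\<dots> = X (?J f \<circ> inv_into UNIV \<tau>) (?J f)" using \<tau> finite_permutes by simp
    finally show ?thesis using x f'(1) by (auto simp: a_def coef_def quot_mor_def)
  qed
  have "X I J = quot_matrix a I J" if I: "I \<in> MI" and J: "J \<in> MI" for I J
  proof -
    let ?f = "block_type J"
    have "X I J = (\<Sum>\<sigma> | \<sigma> permutes {..<d}. of_bool (I = J \<circ> \<sigma>) * X (?J ?f \<circ> \<sigma>) (?J ?f))"
      by (rule key[OF I J block_type_obj[OF J] same_orbit_refl])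
    also have "\<dots> = (\<Sum>\<sigma> | \<sigma> permutes {..<d}. of_bool (I = J \<circ> inv_into UNIV \<sigma>) * X (?J ?f \<circ> inv_into UNIV \<sigma>) (?J ?f))"
      by (rule sum_permutations_inverse)
    also have "\<dots> = quot_matrix a I J"
      unfolding quot_matrix_def
    proof (rule sum.cong[OF refl])
      fix \<sigma> assume "\<sigma> \<in> {\<sigma>. \<sigma> permutes {..<d}}"
      then have \<sigma>: "\<sigma> permutes {..<d}" by simp
      show "of_bool (I = J \<circ> inv_into UNIV \<sigma>) * X (?J ?f \<circ> inv_into UNIV \<sigma>) (?J ?f) =
          (if I \<circ> \<sigma> = J then a (mor_orbit l k d (?f, \<sigma>, block_type I)) else 0)"
        using a_orbit[OF block_type_mor[OF I \<sigma>]] comp_cancel[OF \<sigma>, of I J] by auto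
    qed
    finally show ?thesis .
  qed
  then show thesis using that[OF a] tensor_op_cong by blast
qed

end

theorem theorem19:
  fixes l k d m :: nat
  assumes "l > 0" and "k > 0" and "d > 0" and "m > 0"
    and "k dvd l" and "m > d"
  shows "quot_algebra_action l d m ` carrier (quot_algebra l k d) =
           centralizer (End_tensors (l * m) d)
             (GLZ_action l k d m ` carrier (group_algebra (GLZ l m))) \<and>
         GLZ_action l k d m ` carrier (group_algebra (GLZ l m)) =
           centralizer (End_tensors (l * m) d)
             (quot_algebra_action l d m ` carrier (quot_algebra l k d))"
proof -
  interpret block_setting l k m d
    using assms by unfold_locales auto
  let ?A = "quot_algebra_action l d m ` carrier (quot_algebra l k d)"
  let ?B = "GLZ_action l k d m ` carrier (group_algebra (GLZ l m))"
  let ?C = "centralizer (End_tensors n d)"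
  \<comment> \<open>This one commutation statement yields an inclusion in each of the two
    equalities.\<close>
  have comm: "y \<otimes>\<^bsub>End_tensors n d\<^esub> x = x \<otimes>\<^bsub>End_tensors n d\<^esub> y" if x: "x \<in> ?A" and y: "y \<in> ?B" for x y
  proof -
    obtain b where b: "b \<in> carrier (group_algebra (GLZ l m))" "y = GLZ_action l k d m b"
      using y by blast
    obtain a where a: "a \<in> carrier (quot_algebra l k d)" "x = quot_algebra_action l d m a"
      using x by blast
    show ?thesis
      unfolding a(2) b(2) GLZ_action_eq by (rule equivariant_commutes[OF equivariant_GLZ_action[OF b(1)] a(1)])
  qed
  have A: "?A \<subseteq> carrier (End_tensors n d)" by (auto simp: quot_algebra_action_eq tensor_op_in_End)
  have B: "?B \<subseteq> carrier (End_tensors n d)" by (auto simp: GLZ_action_eq tensor_op_in_End)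
  have "?A \<subseteq> ?C ?B"
    unfolding centralizer_def using A by (intro subsetI CollectI conjI ballI) (blast, rule comm[symmetric])
  moreover have "?B \<subseteq> ?C ?A"
    unfolding centralizer_def using B by (intro subsetI CollectI conjI ballI) (blast, rule comm)
  moreover have "?C ?B \<subseteq> ?A"
  proof
    fix \<phi> assume \<phi>: "\<phi> \<in> ?C ?B"
    then have "\<phi> \<in> carrier (End_tensors n d)" by (simp add: centralizer_def)
    then obtain X where X: "\<phi> = tensor_op n d X" by (rule End_tensors_obtain_matrix)
    obtain a where "a \<in> carrier (quot_algebra l k d)" "tensor_op n d X = tensor_op n d (quot_matrix a)"
      using commutes_quot_matrix[of X] \<phi> unfolding X centralizer_def spanned_def by blast
    then show "\<phi> \<in> ?A" using quot_algebra_action_eq X by auto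
  qed
  moreover have "?C ?A \<subseteq> ?B"
  proof
    fix \<phi> assume \<phi>: "\<phi> \<in> ?C ?A"
    then have "\<phi> \<in> carrier (End_tensors n d)" by (simp add: centralizer_def)
    then obtain Y where Y: "\<phi> = tensor_op n d Y" by (rule End_tensors_obtain_matrix)
    have "equivariant Y"
      using \<phi> unfolding Y centralizer_def by (intro commutes_equivariant) auto
    then show "\<phi> \<in> ?B" using equivariant_spanned Y by (simp add: spanned_def)
  qed
  ultimately show ?thesis by blast
qed

end
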